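(* Let $d\ge 1$ and let $S$ be a finite symmetric generating set of $\mathbb{Z}^d$. Let $Q$ be the convex hull of $S$ in $\mathbb{R}^d$, $L=\partial Q$, and let $\mu$ be the cone measure on $L$. Define measures $\nu_n$ and $\nu$ on $\mathbb{R}^d$ by setting, for Lebesgue-measurable sets $A\subset\mathbb{R}^d$, $$\nu_n(A)=\frac{\#(\frac1n S_n\cap A)}{\#S_n},\qquad \nu(A)=\mu(A\cap L).$$ Then $\nu_n\to\nu$ weakly.
   Context: Symmetric means $S=-S$. The word length $|\mathsf{w}|$ of $\mathsf{w}\in\mathbb{Z}^d$ is the minimal number of elements of $S$ (with repetition) summing to $\mathsf{w}$; $S_n=\{\mathsf{w}\in\mathbb{Z}^d: |\mathsf{w}|=n\}$. The cone measure on $L$ is $\mu(\tau)=\mathrm{Vol}(\hat\tau)/\mathrm{Vol}(Q)$, where $\hat\tau=\{t\mathsf{x}:0\le t\le 1,\ \mathsf{x}\in\tau\}$ and $\mathrm{Vol}$ is Lebesgue measure on $\mathbb{R}^d$. Weak convergence $\nu_n\to\nu$ of Borel probability measures on $X$ means $\int_X f\,d\nu_n\to\int_X f\,d\nu$ for every bounded continuous $f:X\to\mathbb{R}$ (equivalently, $\liminf_n\nu_n(U)\ge\nu(U)$ for every open $U\subseteq X$). *)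

theory Defs
  imports "HOL-Probability.Probability_Measure" "HOL-Computational_Algebra.Group_Closure"
begin

definition of_lattice :: "int ^ 'n \<Rightarrow> real ^ 'n" where
  "of_lattice w = (\<chi> i. real_of_int (w $ i))"

definition symmetric_set :: "'a::group_add set \<Rightarrow> bool" where
  "symmetric_set S \<longleftrightarrow> S = uminus ` S"

definition generating_set :: "'a::ab_group_add set \<Rightarrow> bool" where
  "generating_set S \<longleftrightarrow> group_closure S = UNIV"

(* Meaningful only if some list over S sums to w, as is the case for every w when S is
   symmetric and generating. *)
definition word_length :: "'a::monoid_add set \<Rightarrow> 'a \<Rightarrow> nat" where
  "word_length S w = (LEAST k. \<exists>ws. set ws \<subseteq> S \<and> length ws = k \<and> sum_list ws = w)"

definition word_sphere :: "'a::monoid_add set \<Rightarrow> nat \<Rightarrow> 'a set" where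
  "word_sphere S n = {w. word_length S w = n}"

definition word_polytope :: "(int ^ 'n) set \<Rightarrow> (real ^ 'n) set" where
  "word_polytope S = convex hull (of_lattice ` S)"

definition cone_over :: "'a::real_vector set \<Rightarrow> 'a set" where
  "cone_over T = {t *\<^sub>R x | t x. 0 \<le> t \<and> t \<le> 1 \<and> x \<in> T}"

definition cone_measure :: "'a::euclidean_space set \<Rightarrow> 'a set \<Rightarrow> real" where
  "cone_measure Q T = measure lebesgue (cone_over T) / measure lebesgue Q"

(* The next two measures live on the Borel sets: every subset of the null set frontier Q is
   Lebesgue measurable, but the cone over it need not be. Recall that measure_of returns the
   zero measure if the given set function is not countably additive; weak_conv_borel below
   therefore demands probability measures. *)

(* For n = 0 this is the point mass at 0, since 1 / 0 = 0 and the sphere of radius 0 is {0}. *)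
definition sphere_measure :: "(int ^ 'n) set \<Rightarrow> nat \<Rightarrow> (real ^ 'n) measure" where
  "sphere_measure S n = measure_of UNIV (sets borel)
     (\<lambda>A. ennreal (real (card ((*\<^sub>R) (1 / real n) ` of_lattice ` word_sphere S n \<inter> A))
                    / real (card (word_sphere S n))))"

definition limit_measure :: "(int ^ 'n) set \<Rightarrow> (real ^ 'n) measure" where
  "limit_measure S = measure_of UNIV (sets borel)
     (\<lambda>A. ennreal (cone_measure (word_polytope S) (A \<inter> frontier (word_polytope S))))"

(* The library's weak_conv_m covers only measures on the real line. *)
definition weak_conv_borel :: "(nat \<Rightarrow> 'a::topological_space measure) \<Rightarrow> 'a measure \<Rightarrow> bool" where
  "weak_conv_borel N M \<longleftrightarrow>
     (\<forall>n. prob_space (N n) \<and> sets (N n) = sets borel) \<and>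
     prob_space M \<and> sets M = sets borel \<and>
     (\<forall>f :: 'a \<Rightarrow> real. continuous_on UNIV f \<longrightarrow> bounded (range f) \<longrightarrow>
        (\<lambda>n. integral\<^sup>L (N n) f) \<longlonglongrightarrow> integral\<^sup>L M f)"

end

(*
  Write Q = {x. a . x <= 1 for all a in A} with A finite, and N for its gauge, so that N = max_a a . x.
  Word length differs from N by a bounded amount. Inside the cone over the face a . x = 1, beyond a bounded
  distance from its walls, adding a generator s with a . s = 1 raises the word length by exactly one.
  Translation by such generators therefore carries S_n to S_(n+1) up to o(n^(d-1)) points near the walls,
  so the sums of a slowly varying function, homogeneous of degree 0, over S_n change by only o(n^(d-1))
  from n to n + 1. The sums over the balls are known up to O(n^(d-1)) from the volume of the dilates
  of Q, and a sequence of that size whose second differences are o(n^(d-1)) has first differences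
  o(n^(d-1)). This determines the sums over spheres asymptotically.
*)

theory Submission
  imports Defs "HOL-Analysis.Analysis"
begin

section \<open>Word length\<close>

text \<open>The obstacle is one of orders of magnitude: the error with which the gauge predicts a
  ball is as large as a whole sphere, so subtracting consecutive balls says nothing by itself, and
  closeness of word length to the gauge must be complemented by an exact statement. Exactness comes
  from integrality. Once the linear part along a face is removed, the word length is a nonincreasing
  integer, bounded below, along the multiples of the sum of the face generators. It stabilises, and
  does so simultaneously for the finitely many remainders left by rounding conic combinations down.
  Counting is replaced by integration: word length is extended to be constant on unit cubes, so that
  translation by a generator becomes a measure-preserving change of variables. The slowly varying
  function is the test function composed with the radial projection to the unit sphere of the gauge.
  The limit measure is the image of the uniform measure on the unit ball under the same projection,
  and the test function 1 supplies the normalisation.\<close>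

lemma word_length_le:
  "set ws \<subseteq> S \<Longrightarrow> sum_list ws = w \<Longrightarrow> word_length S w \<le> length ws"
  unfolding word_length_def by (rule Least_le) auto

lemma word_length_0 [simp]: "word_length S 0 = 0"
  using word_length_le[of "[]" S 0] by simp

locale word_gens =
  fixes S :: "'a::ab_group_add set"
  assumes symmetric: "symmetric_set S"
    and generating: "generating_set S"
begin

lemma uminus_mem: "s \<in> S \<Longrightarrow> - s \<in> S"
  using symmetric unfolding symmetric_set_def by auto

lemma ex_word: "\<exists>ws. set ws \<subseteq> S \<and> sum_list ws = w"
proof -
  have "w \<in> group_closure S" using generating by (simp add: generating_set_def)
  then show ?thesis
  proof induction
    case (base s)
    then show ?case by (auto intro: exI[of _ "[]"] exI[of _ "[s]"])
  next
    case (diff s t)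
    then obtain us vs where "set us \<subseteq> S" "sum_list us = s" "set vs \<subseteq> S" "sum_list vs = t"
      by blast
    moreover have "sum_list (map uminus vs) = - sum_list vs"
      by (induction vs) auto
    ultimately show ?case using uminus_mem
      by (intro exI[of _ "us @ map uminus vs"]) auto
  qed
qed

lemma geodesic: obtains ws where "set ws \<subseteq> S" "length ws = word_length S w" "sum_list ws = w"
proof -
  have "\<exists>k ws. set ws \<subseteq> S \<and> length ws = k \<and> sum_list ws = w" using ex_word by blast
  then have "\<exists>ws. set ws \<subseteq> S \<and> length ws = word_length S w \<and> sum_list ws = w"
    unfolding word_length_def by (rule LeastI_ex)
  then show ?thesis using that by blast
qed

lemma word_length_add: "word_length S (v + w) \<le> word_length S v + word_length S w"
proof -
  obtain us where "set us \<subseteq> S" "length us = word_length S v" "sum_list us = v"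
    by (rule geodesic)
  moreover obtain vs where "set vs \<subseteq> S" "length vs = word_length S w" "sum_list vs = w"
    by (rule geodesic)
  ultimately show ?thesis using word_length_le[of "us @ vs" S "v + w"] by simp
qed

lemma word_length_gen: "s \<in> S \<Longrightarrow> word_length S s \<le> 1"
  using word_length_le[of "[s]" S s] by simp

lemma word_length_eq_0_iff: "word_length S w = 0 \<longleftrightarrow> w = 0"
  using geodesic[of w]
  by (metis length_0_conv sum_list.Nil word_length_0)

lemma word_length_Suc:
  assumes "word_length S w = Suc m"
  obtains w' where "word_length S w' = m"
proof -
  obtain ws where ws: "set ws \<subseteq> S" "length ws = Suc m" "sum_list ws = w"
    using geodesic[of w] assms by auto
  then obtain s us where us: "ws = s # us" by (cases ws) auto
  have "word_length S (sum_list us) \<le> m" using word_length_le[of us S] us ws by auto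
  moreover have "Suc m \<le> 1 + word_length S (sum_list us)"
    using word_length_add[of s "sum_list us"] word_length_gen[of s] us ws assms by auto
  ultimately show ?thesis using that[of "sum_list us"] by simp
qed

text \<open>Deleting a letter of a geodesic lowers the length by exactly one, so every smaller
  length is reached by descent from \<open>w\<close>.\<close>

lemma word_sphere_nonempty:
  assumes "n \<le> word_length S w"
  shows "word_sphere S n \<noteq> {}"
  using assms
proof (induction "word_length S w - n" arbitrary: w)
  case 0
  then show ?case by (auto simp: word_sphere_def)
next
  case (Suc k)
  then obtain m where "word_length S w = Suc m" by (cases "word_length S w") auto
  then obtain w' where "word_length S w' = m" by (rule word_length_Suc)
  then show ?case using Suc.hyps(1)[of w'] Suc.hyps(2) Suc.prems \<open>word_length S w = Suc m\<close> by simp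
qed

text \<open>Each letter of \<open>us\<close> is completed to \<open>\<Sum>F\<close> by the remaining
  \<open>card F - 1\<close> elements of \<open>F\<close>.\<close>

lemma complement_word:
  assumes "finite F" "set us \<subseteq> F"
  obtains vs where "set vs \<subseteq> F" "length vs + length us = length us * card F"
    "sum_list us + sum_list vs = (\<Sum>i<length us. \<Sum>F)"
proof -
  have "\<exists>vs. set vs \<subseteq> F \<and> length vs + length us = length us * card F \<and>
    sum_list us + sum_list vs = (\<Sum>i<length us. \<Sum>F)"
    using assms(2)
  proof (induction us)
    case (Cons s us)
    then obtain vs where vs: "set vs \<subseteq> F" "length vs + length us = length us * card F"
      "sum_list us + sum_list vs = (\<Sum>i<length us. \<Sum>F)" by auto
    obtain xs where xs: "set xs = F - {s}" "distinct xs"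
      using finite_distinct_list[of "F - {s}"] assms(1) by auto
    have "length xs = card F - 1" using xs Cons.prems by (simp flip: distinct_card)
    moreover have "card F > 0" using Cons.prems assms(1) by (auto simp: card_gt_0_iff)
    moreover have "s + sum_list xs = \<Sum>F"
      using xs Cons.prems assms(1) sum.remove[of F s "\<lambda>x. x"] by (simp add: distinct_sum_list_conv_Sum)
    moreover have "sum_list (s # us) + sum_list (xs @ vs) = (s + sum_list xs) + (sum_list us + sum_list vs)"
      by (simp add: algebra_simps)
    ultimately show ?case using vs xs
      by (intro exI[of _ "xs @ vs"]) (auto simp: add.commute)
  qed auto
  then show ?thesis using that by blast
qed

text \<open>The integer \<open>|e + k T| - k |F|\<close>, where \<open>T\<close> is the sum of \<open>F\<close>, is
  nonincreasing in \<open>k\<close> and bounded below by \<open>l e\<close>, hence eventually constant.\<close>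

lemma eventually_additive_length:
  assumes finF: "finite F" and FS: "F \<subseteq> S" and finE: "finite E"
    and add: "\<And>x y. l (x + y) = l x + (l y :: real)" and one: "\<And>s. s \<in> F \<Longrightarrow> l s = 1"
    and below: "\<And>w. l w \<le> word_length S w"
  obtains k :: nat where "\<And>e us. e \<in> E \<Longrightarrow> set us \<subseteq> F \<Longrightarrow>
    word_length S (e + (\<Sum>i<k. \<Sum>F) + sum_list us)
      = word_length S (e + (\<Sum>i<k. \<Sum>F)) + length us"
proof -
  let ?T = "\<lambda>k::nat. (\<Sum>i<k. \<Sum>F)"
  have T_add: "?T (j + k) = ?T j + ?T k" for j k
    by (induction k) (auto simp: algebra_simps)
  obtain fs where fs: "set fs = F" "distinct fs" using finF finite_distinct_list by blast
  have len_T: "word_length S (w + ?T k) \<le> word_length S w + k * card F" for w k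
  proof (induction k)
    case (Suc k)
    have "word_length S (\<Sum>F) \<le> card F"
      using word_length_le[of fs S "\<Sum>F"] fs FS distinct_card[OF fs(2)]
      by (simp add: distinct_sum_list_conv_Sum)
    then show ?case
      using word_length_add[of "w + ?T k" "\<Sum>F"] Suc by (simp add: algebra_simps)
  qed simp
  have zero: "l 0 = 0" using add[of 0 0] by simp
  have lam_sum: "l (\<Sum>F) = card F"
  proof -
    have "l (\<Sum>G) = card G" if "finite G" "G \<subseteq> F" for G
      using that by (induction G) (auto simp: zero add one)
    then show ?thesis using finF by simp
  qed
  have lam_T: "l (?T k) = k * card F" for k
    by (induction k) (auto simp: zero add lam_sum algebra_simps)
  have ev: "\<forall>\<^sub>F k in sequentially. \<forall>us. set us \<subseteq> F \<longrightarrow>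
    word_length S (e + ?T k + sum_list us) = word_length S (e + ?T k) + length us" for e
  proof -
    \<comment> \<open>The shift by \<open>c\<close> keeps the quantity nonnegative, so that the
      truncated subtraction in \<open>h\<close> is exact; \<open>h_ge\<close> records this.\<close>
    obtain c :: nat where c: "- l e \<le> c" using real_arch_simple by blast
    define h where "h k = word_length S (e + ?T k) + c - k * card F" for k
    have h_ge: "k * card F \<le> word_length S (e + ?T k) + c" for k
    proof -
      have "l e + k * card F \<le> word_length S (e + ?T k)"
        using below[of "e + ?T k"] by (simp add: add lam_T)
      then have "real (k * card F) \<le> real (word_length S (e + ?T k) + c)"
        using c by simp
      then show ?thesis by (simp only: of_nat_le_iff)
    qed
    \<comment> \<open>By \<open>len_T\<close> the value of \<open>h\<close> cannot grow after
      \<open>k0\<close>, so it stays at its minimum from there on.\<close>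
    obtain k0 where k0: "\<And>k. h k0 \<le> h k"
      using ex_has_least_nat[of "\<lambda>_. True" 0 h] by auto
    have "word_length S (e + ?T k + sum_list us) = word_length S (e + ?T k) + length us"
      if k: "k0 \<le> k" and us: "set us \<subseteq> F" for k us
    proof (rule antisym)
      have "word_length S (sum_list us) \<le> length us"
        using us FS by (intro word_length_le) auto
      then show "word_length S (e + ?T k + sum_list us) \<le> word_length S (e + ?T k) + length us"
        using word_length_add[of "e + ?T k" "sum_list us"] by linarith
      \<comment> \<open>The complement leads on to \<open>e + ?T (k + length us)\<close>. A saving
        on \<open>us\<close> would be inherited by that later point and push \<open>h\<close> below
        its minimum.\<close>
      obtain vs where vs: "set vs \<subseteq> F" "length vs + length us = length us * card F"
        "sum_list us + sum_list vs = ?T (length us)"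
        using complement_word[OF finF us] by blast
      have "word_length S (sum_list vs) \<le> length vs"
        using vs FS by (intro word_length_le) auto
      moreover have "e + ?T (k + length us) = (e + ?T k + sum_list us) + sum_list vs"
        unfolding T_add vs(3)[symmetric] by (simp add: algebra_simps)
      ultimately have 1: "word_length S (e + ?T (k + length us))
          \<le> word_length S (e + ?T k + sum_list us) + length vs"
        using word_length_add[of "e + ?T k + sum_list us" "sum_list vs"] by (metis add_left_mono order_trans)
      have "word_length S (e + ?T k) \<le> word_length S (e + ?T k0) + (k - k0) * card F"
        using len_T[of "e + ?T k0" "k - k0"] k T_add[of k0 "k - k0"] by (simp add: algebra_simps)
      moreover have "k * card F = k0 * card F + (k - k0) * card F"
        using k by (simp flip: add_mult_distrib)
      ultimately have "h k \<le> h k0"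
        using h_ge[of k] h_ge[of k0] unfolding h_def by linarith
      then have "h k \<le> h (k + length us)" using k0[of "k + length us"] by linarith
      then show "word_length S (e + ?T k) + length us \<le> word_length S (e + ?T k + sum_list us)"
        using 1 vs(2) h_ge[of k] h_ge[of "k + length us"] unfolding h_def add_mult_distrib by linarith
    qed
    then show ?thesis unfolding eventually_sequentially by blast
  qed
  have "\<forall>\<^sub>F k in sequentially. \<forall>e\<in>E. \<forall>us. set us \<subseteq> F \<longrightarrow>
    word_length S (e + ?T k + sum_list us) = word_length S (e + ?T k) + length us"
    using finE ev by (intro eventually_ball_finite) auto
  then obtain k :: nat where "\<forall>e\<in>E. \<forall>us. set us \<subseteq> F \<longrightarrow>
    word_length S (e + ?T k + sum_list us) = word_length S (e + ?T k) + length us"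
    unfolding eventually_sequentially by blast
  then show ?thesis using that[of k] by blast
qed

end

section \<open>The gauge of a polytope\<close>

text \<open>The gauge \<open>N\<close> need not be symmetric, so Lipschitz estimates use both
  \<open>N (x - y)\<close> and \<open>N (y - x)\<close>. Boundedness of the unit ball makes
  \<open>N\<close> positive away from 0.\<close>

locale gauge =
  fixes A :: "'a::euclidean_space set"
  assumes finite_A: "finite A"
    and bounded_unit: "bounded {x. \<forall>a\<in>A. a \<bullet> x \<le> 1}"
begin

definition N :: "'a \<Rightarrow> real" where
  "N x = Max ((\<lambda>a. a \<bullet> x) ` A)"

lemma A_nonempty: "A \<noteq> {}"
  using bounded_unit not_bounded_UNIV[where 'a='a] by auto

lemma N_le_iff: "N x \<le> t \<longleftrightarrow> (\<forall>a\<in>A. a \<bullet> x \<le> t)"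
  unfolding N_def using finite_A A_nonempty by (subst Max_le_iff) auto

lemma inner_le_N: "a \<in> A \<Longrightarrow> a \<bullet> x \<le> N x"
  using N_le_iff[of x "N x"] by auto

lemma N_attained: obtains a where "a \<in> A" "N x = a \<bullet> x"
proof -
  have "N x \<in> (\<lambda>a. a \<bullet> x) ` A"
    unfolding N_def using finite_A A_nonempty by (intro Max_in) auto
  then show ?thesis using that by auto
qed

lemma N_eqI: "a \<in> A \<Longrightarrow> (\<And>b. b \<in> A \<Longrightarrow> b \<bullet> x \<le> a \<bullet> x) \<Longrightarrow> N x = a \<bullet> x"
  by (metis N_attained inner_le_N order_antisym)

lemma N_zero [simp]: "N 0 = 0"
  by (metis N_attained inner_zero_right)

lemma N_add: "N (x + y) \<le> N x + N y"
  unfolding N_le_iff inner_add_right by (simp add: add_mono inner_le_N)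

lemma N_scale: "0 \<le> c \<Longrightarrow> N (c *\<^sub>R x) = c * N x"
proof -
  assume c: "0 \<le> c"
  obtain a where a: "a \<in> A" "N x = a \<bullet> x" by (rule N_attained)
  have "N (c *\<^sub>R x) = a \<bullet> (c *\<^sub>R x)"
    by (rule N_eqI) (use a c inner_le_N in \<open>auto intro!: mult_left_mono simp flip: a(2)\<close>)
  then show ?thesis by (simp add: a)
qed

text \<open>Otherwise the whole ray through \<open>x\<close> lies in the unit ball, and its point of
  norm \<open>\<bar>B\<bar> + 1\<close> contradicts the bound \<open>B\<close>.\<close>

lemma N_pos: "x \<noteq> 0 \<Longrightarrow> 0 < N x"
proof (rule ccontr)
  assume x: "x \<noteq> 0" and "\<not> 0 < N x"
  then have le: "a \<bullet> x \<le> 0" if "a \<in> A" for a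
    using inner_le_N[OF that, of x] by simp
  obtain B where B: "\<And>y. \<forall>a\<in>A. a \<bullet> y \<le> 1 \<Longrightarrow> norm y \<le> B"
    using bounded_unit unfolding bounded_iff by auto
  have "norm (((\<bar>B\<bar> + 1) / norm x) *\<^sub>R x) \<le> B"
  proof (rule B, rule ballI)
    fix a assume "a \<in> A"
    then have "((\<bar>B\<bar> + 1) / norm x) * (a \<bullet> x) \<le> 0"
      using le by (intro mult_nonneg_nonpos) auto
    then show "a \<bullet> (((\<bar>B\<bar> + 1) / norm x) *\<^sub>R x) \<le> 1" by simp
  qed
  then show False using x by simp
qed

lemma N_nonneg: "0 \<le> N x"
  using N_pos[of x] by (cases "x = 0") auto

lemma ex_norm_le_N: obtains R where "R > 0" "\<And>x. norm x \<le> R * N x"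
proof -
  obtain B where B: "\<And>y. \<forall>a\<in>A. a \<bullet> y \<le> 1 \<Longrightarrow> norm y \<le> B"
    using bounded_unit unfolding bounded_iff by auto
  have "norm x \<le> (\<bar>B\<bar> + 1) * N x" for x
  proof (cases "x = 0")
    case False
    then have p: "0 < N x" by (rule N_pos)
    have "norm ((1 / N x) *\<^sub>R x) \<le> B"
      using p by (intro B) (auto simp: field_simps inner_le_N)
    then have "norm x \<le> B * N x"
      using p by (simp add: field_simps)
    also have "\<dots> \<le> (\<bar>B\<bar> + 1) * N x"
      using p by (intro mult_right_mono) auto
    finally show ?thesis .
  qed auto
  then show ?thesis by (intro that[of "\<bar>B\<bar> + 1"]) auto
qed

lemma ex_N_le_norm: obtains C where "C > 0" "\<And>x. N x \<le> C * norm x"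
proof -
  have "N x \<le> (sum norm A + 1) * norm x" for x
    unfolding N_le_iff
  proof
    fix a assume a: "a \<in> A"
    have "a \<bullet> x \<le> norm a * norm x" by (rule norm_cauchy_schwarz)
    also have "norm a \<le> sum norm A" using a finite_A by (intro member_le_sum) auto
    finally show "a \<bullet> x \<le> (sum norm A + 1) * norm x"
      by (simp add: algebra_simps mult_right_mono) (smt (verit, best) norm_ge_zero mult_right_mono
        \<open>a \<bullet> x \<le> norm a * norm x\<close> \<open>norm a \<le> sum norm A\<close>)
  qed
  moreover have "sum norm A + 1 > 0" by (smt (verit) sum_nonneg norm_ge_zero)
  ultimately show ?thesis using that by blast
qed

lemma N_diff_le: "N x \<le> N y + N (x - y)"
  using N_add[of y "x - y"] by simp

lemma continuous_on_N: "continuous_on S N"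
proof -
  have "continuous_on S (\<lambda>x. Max ((\<lambda>a. a \<bullet> x) ` B))" if "finite B" "B \<noteq> {}" for B :: "'a set"
    using that
  proof (induction B rule: finite_ne_induct)
    case (insert b B)
    have "(\<lambda>x. Max ((\<lambda>a. a \<bullet> x) ` insert b B)) = (\<lambda>x. max (b \<bullet> x) (Max ((\<lambda>a. a \<bullet> x) ` B)))"
      using insert by auto
    then show ?case using insert by (auto intro!: continuous_intros)
  qed (auto intro!: continuous_intros)
  then show ?thesis using finite_A A_nonempty by (auto simp: N_def[abs_def])
qed

lemma measurable_N [measurable]: "N \<in> borel_measurable borel"
  by (intro borel_measurable_continuous_onI continuous_on_N)

lemma bounded_N_less: "bounded {x. N x < t}"
proof -
  obtain R where R: "R > 0" "\<And>x. norm x \<le> R * N x" using ex_norm_le_N by blast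
  show ?thesis
    unfolding bounded_iff
  proof (intro exI[of _ "R * t"] ballI)
    fix x assume "x \<in> {x. N x < t}"
    then show "norm x \<le> R * t" using R(1) R(2)[of x]
      by (smt (verit) mem_Collect_eq mult_left_mono)
  qed
qed

lemma open_N_less: "open {x. N x < t}"
  by (intro open_Collect_less continuous_on_N continuous_on_const)

end

section \<open>Integrals over bounded sets, differences of powers, and scaling of Lebesgue
  measure\<close>

lemma integrable_on_bounded_set:
  fixes g :: "'a::euclidean_space \<Rightarrow> real"
  assumes "bounded U" and [measurable]: "U \<in> sets borel" "g \<in> borel_measurable borel"
    and B: "\<And>x. \<bar>g x\<bar> \<le> B"
  shows "integrable lborel (\<lambda>x. indicator U x * g x)"
proof (rule Bochner_Integration.integrable_bound)
  have "emeasure lborel U < \<infinity>" by (rule emeasure_bounded_finite) (rule assms)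
  then show "integrable lborel (\<lambda>x. indicator U x * B)" by (auto intro!: integrable_mult_left)
  have B0: "0 \<le> B" using B[of undefined] by linarith
  show "AE x in lborel. norm (indicator U x * g x) \<le> norm (indicator U x * B)"
    using B B0 by (intro AE_I2) (auto simp: indicator_def)
qed auto

lemma abs_integral_on_le:
  fixes h :: "'a::euclidean_space \<Rightarrow> real"
  assumes "bounded U" "U \<in> sets borel" "integrable lborel h"
    and B: "\<And>x. \<bar>h x\<bar> \<le> indicator U x * B"
  shows "\<bar>\<integral>x. h x \<partial>lborel\<bar> \<le> B * measure lborel U"
proof -
  have fin: "emeasure lborel U < \<infinity>" by (rule emeasure_bounded_finite) (rule assms)
  have "norm (\<integral>x. h x \<partial>lborel) \<le> (\<integral>x. indicator U x * B \<partial>lborel)"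
    using assms fin 
    by (intro Bochner_Integration.integral_norm_bound_integral) (auto intro!: integrable_mult_left)
  also have "\<dots> = B * measure lborel U" using assms by simp
  finally show ?thesis by simp
qed

text \<open>The quotient is the difference quotient at 0 of
  \<open>(1 + b * x) ^ d - (1 + c * x) ^ d\<close>, taken at \<open>x = 1 / n\<close>.\<close>

lemma tendsto_power_diff:
  fixes b c :: real
  assumes d: "d > 0"
  shows "(\<lambda>n. ((real n + b) ^ d - (real n + c) ^ d) / real n ^ (d - 1)) \<longlonglongrightarrow> d * (b - c)"
proof -
  let ?f = "\<lambda>x. (1 + b * x) ^ d - (1 + c * x) ^ d"
  have "(?f has_field_derivative d * (b - c)) (at 0)"
    by (auto intro!: derivative_eq_intros simp: algebra_simps)
  then have "((\<lambda>x. ?f x / x) \<longlongrightarrow> d * (b - c)) (at 0)"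
    by (simp add: has_field_derivative_iff)
  moreover have "filterlim (\<lambda>n. 1 / real n) (at 0) sequentially"
    unfolding filterlim_at
    using eventually_gt_at_top[of 0] by (auto intro!: lim_1_over_n elim!: eventually_mono)
  ultimately have "(\<lambda>n. ?f (1 / real n) / (1 / real n)) \<longlonglongrightarrow> d * (b - c)"
    by (rule filterlim_compose)
  moreover have "\<forall>\<^sub>F n in sequentially. ?f (1 / real n) / (1 / real n)
    = ((real n + b) ^ d - (real n + c) ^ d) / real n ^ (d - 1)"
    using eventually_gt_at_top[of 0]
  proof eventually_elim
    case (elim n)
    have *: "(1 + b * (1 / real n)) ^ d = (real n + b) ^ d / real n ^ d" for b
    proof -
      have "1 + b * (1 / real n) = (real n + b) / real n" using elim by (simp add: field_simps)
      then show ?thesis by (simp only: power_divide)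
    qed
    have "real n ^ d = real n * real n ^ (d - 1)" using d by (simp flip: power_Suc)
    then show ?case unfolding * using elim by (simp flip: diff_divide_distrib)
  qed
  ultimately show ?thesis by (rule Lim_transform_eventually)
qed

lemma lborel_integral_scaleR:
  fixes f :: "'a::euclidean_space \<Rightarrow> real"
  assumes [measurable]: "f \<in> borel_measurable borel" and t: "t > 0"
  shows "(\<integral>x. f x \<partial>lborel) = t ^ DIM('a) * (\<integral>x. f (t *\<^sub>R x) \<partial>lborel)"
proof -
  have "(lborel :: 'a measure) = density (distr lborel borel (\<lambda>x. 0 + t *\<^sub>R x)) (\<lambda>_. \<bar>t\<bar> ^ DIM('a))"
    (is "_ = ?M") by (rule lborel_affine) (use t in simp)
  then have "(\<integral>x. f x \<partial>lborel) = (\<integral>x. f x \<partial>?M)" by (rule arg_cong)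
  also have "\<dots> = t ^ DIM('a) * (\<integral>x. f (t *\<^sub>R x) \<partial>lborel)"
    using t by (subst integral_density) (auto simp: integral_distr)
  finally show ?thesis .
qed

section \<open>Volumes of shells and of neighbourhoods of the walls between cones\<close>

context gauge
begin

lemma integral_N_less:
  assumes [measurable]: "g \<in> borel_measurable borel"
    and hom: "\<And>x t. t > 0 \<Longrightarrow> g (t *\<^sub>R x) = g x" and t: "t > 0"
  shows "(\<integral>x. indicator {x. N x < t} x * g x \<partial>lborel)
    = t ^ DIM('a) * (\<integral>x. indicator {x. N x < 1} x * (g x :: real) \<partial>lborel)"
  using t by (subst lborel_integral_scaleR[OF _ t]) (auto simp: indicator_def N_scale hom)

lemma finite_measure_N_less: "emeasure lborel {x. N x < t} < \<infinity>"
  using bounded_N_less by (rule emeasure_bounded_finite)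

lemma measure_N_less:
  assumes [measurable]: "W \<in> sets borel"
    and cone: "\<And>x t. t > 0 \<Longrightarrow> t *\<^sub>R x \<in> W \<longleftrightarrow> x \<in> W" and t: "t > 0"
  shows "measure lborel ({x. N x < t} \<inter> W) = t ^ DIM('a) * measure lborel ({x. N x < 1} \<inter> W)"
proof -
  have "measure lborel ({x. N x < s} \<inter> W)
    = (\<integral>x. indicator {x. N x < s} x * indicator W x \<partial>lborel)" for s
    by (simp flip: indicator_inter_arith)
  then show ?thesis
    using integral_N_less[of "indicator W" t] cone t by (simp add: indicator_def)
qed

definition shell :: "real \<Rightarrow> real \<Rightarrow> 'a set" where
  "shell r K = {x. \<bar>N x - r\<bar> \<le> K}"

lemma shell_measurable [measurable]: "shell r K \<in> sets borel"
  unfolding shell_def by measurable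

lemma bounded_shell: "bounded (shell r K)"
  by (rule bounded_subset[OF bounded_N_less[of "r + K + 1"]]) (auto simp: shell_def)

lemma measure_shell_le:
  assumes [measurable]: "W \<in> sets borel"
    and cone: "\<And>x t. t > 0 \<Longrightarrow> t *\<^sub>R x \<in> W \<longleftrightarrow> x \<in> W" and r: "r > K" and K: "K \<ge> 0"
  shows "measure lborel (shell r K \<inter> W)
    \<le> ((r + (K + 1)) ^ DIM('a) - (r + (- K)) ^ DIM('a)) * measure lborel ({x. N x < 1} \<inter> W)"
proof -
  let ?B = "\<lambda>t. {x. N x < t} \<inter> W"
  have fin: "emeasure lborel (?B t) < \<infinity>" for t
    by (rule emeasure_bounded_finite) (auto intro: bounded_subset[OF bounded_N_less[of t]])
  \<comment> \<open>The shell is closed while the balls are open, hence the outer radius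
    \<open>r + (K + 1)\<close>.\<close>
  have "measure lborel (shell r K \<inter> W) \<le> measure lborel (?B (r + (K + 1)) - ?B (r + (- K)))"
  proof (rule measure_mono_fmeasurable)
    show "?B (r + (K + 1)) - ?B (r + (- K)) \<in> fmeasurable lborel"
      by (intro fmeasurable_Diff fmeasurableI fin) auto
  qed (auto simp: shell_def)
  also have "\<dots> = measure lborel (?B (r + (K + 1))) - measure lborel (?B (r + (- K)))"
    using fin[of "r + (K + 1)"] K by (intro measure_Diff) auto
  also have "\<dots> = ((r + (K + 1)) ^ DIM('a) - (r + (- K)) ^ DIM('a)) * measure lborel (?B 1)"
    using r K by (subst (1 2) measure_N_less) (auto simp: cone algebra_simps)
  finally show ?thesis .
qed

text \<open>\<open>C\<close> depends on \<open>K\<close> only and is fixed before the conical set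
  \<open>W\<close>. \<open>W\<close> can therefore be made thin afterwards, as in
  \<open>measure_shell_walls_tendsto\<close>.\<close>

lemma ex_shell_bound:
  assumes K: "K \<ge> 0"
  obtains C where "C > 0"
    "\<And>W. W \<in> sets borel \<Longrightarrow> (\<And>x t. t > 0 \<Longrightarrow> t *\<^sub>R x \<in> W \<longleftrightarrow> x \<in> W) \<Longrightarrow>
      \<forall>\<^sub>F n in sequentially. measure lborel (shell (real n) K \<inter> W)
        \<le> C * real n ^ (DIM('a) - 1) * measure lborel ({x. N x < 1} \<inter> W)"
proof -
  let ?c = "DIM('a) * ((K + 1) - (- K)) + 1 :: real"
  have "\<forall>\<^sub>F n in sequentially. measure lborel (shell (real n) K \<inter> W)
        \<le> ?c * real n ^ (DIM('a) - 1) * measure lborel ({x. N x < 1} \<inter> W)"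
    if W: "W \<in> sets borel" "\<And>x t. t > 0 \<Longrightarrow> t *\<^sub>R x \<in> W \<longleftrightarrow> x \<in> W" for W
  proof -
    have "\<forall>\<^sub>F n in sequentially. ((real n + (K + 1)) ^ DIM('a) - (real n + (- K)) ^ DIM('a))
        / real n ^ (DIM('a) - 1) < ?c"
      by (rule order_tendstoD(2)[OF tendsto_power_diff]) auto
    moreover have "\<forall>\<^sub>F n in sequentially. real n > K"
      by (rule eventually_gt_at_top[THEN eventually_compose_filterlim, OF filterlim_real_sequentially])
    moreover note eventually_gt_at_top[of 0]
    ultimately show ?thesis
    proof eventually_elim
      case (elim n)
      have "(real n + (K + 1)) ^ DIM('a) - (real n + (- K)) ^ DIM('a)
          \<le> ?c * real n ^ (DIM('a) - 1)"
        using elim by (simp add: divide_less_eq split: if_splits)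
      then have "((real n + (K + 1)) ^ DIM('a) - (real n + (- K)) ^ DIM('a)) * measure lborel ({x. N x < 1} \<inter> W)
          \<le> ?c * real n ^ (DIM('a) - 1) * measure lborel ({x. N x < 1} \<inter> W)"
        by (rule mult_right_mono) simp
      moreover have "measure lborel (shell (real n) K \<inter> W) \<le>
        ((real n + (K + 1)) ^ DIM('a) - (real n + (- K)) ^ DIM('a)) * measure lborel ({x. N x < 1} \<inter> W)"
        by (rule measure_shell_le) (use W elim(2) K in auto)
      ultimately show ?case by linarith
    qed
  qed
  moreover have "?c > 0" using K by (intro add_nonneg_pos mult_nonneg_nonneg) auto
  ultimately show ?thesis using that by blast
qed

text \<open>Slabs around all hyperplanes \<open>a \<bullet> x = b \<bullet> x\<close>, whether or
  not the faces of \<open>a\<close> and \<open>b\<close> are adjacent.\<close>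

definition walls :: "real \<Rightarrow> 'a set" where
  "walls R = (\<Union>(a, b)\<in>{(a, b) \<in> A \<times> A. a \<noteq> b}. {x. \<bar>(a - b) \<bullet> x\<bar> \<le> R})"

text \<open>The scale-invariant counterpart of \<open>walls\<close>: the width grows with
  \<open>N x\<close>, so that the volume bound for conical sets applies.\<close>

definition wall_cones :: "real \<Rightarrow> 'a set" where
  "wall_cones e = (\<Union>(a, b)\<in>{(a, b) \<in> A \<times> A. a \<noteq> b}. {x. \<bar>(a - b) \<bullet> x\<bar> \<le> e * N x})"

lemma finite_pairs: "finite {(a, b) \<in> A \<times> A. a \<noteq> b}"
  using finite_A by (auto intro: finite_subset[of _ "A \<times> A"])

lemma walls_measurable [measurable]: "walls R \<in> sets borel"
  unfolding walls_def by (intro sets.finite_UN finite_pairs) auto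

lemma wall_cones_measurable [measurable]: "wall_cones e \<in> sets borel"
  unfolding wall_cones_def by (intro sets.finite_UN finite_pairs) auto

text \<open>The sets decrease to a subset of finitely many hyperplanes, which is null; continuity
  from above gives the limit.\<close>

lemma measure_wall_cones_tendsto:
  "(\<lambda>k. measure lborel ({x. N x < 1} \<inter> wall_cones (1 / real (Suc k)))) \<longlonglongrightarrow> 0"
proof -
  let ?W = "\<lambda>k. {x. N x < 1} \<inter> wall_cones (1 / real (Suc k))"
  have "decseq ?W"
  proof (rule decseq_SucI)
    fix k
    have "1 / real (Suc (Suc k)) * N x \<le> 1 / real (Suc k) * N x" for x
      by (intro mult_right_mono N_nonneg) (auto simp: field_simps)
    then have "\<bar>(a - b) \<bullet> x\<bar> \<le> 1 / real (Suc k) * N x"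
      if "\<bar>(a - b) \<bullet> x\<bar> \<le> 1 / real (Suc (Suc k)) * N x" for a b x
      using that order_trans by blast
    then show "?W (Suc k) \<subseteq> ?W k"
      unfolding wall_cones_def by blast
  qed
  moreover have "emeasure lborel (?W k) \<noteq> \<infinity>" for k
    using emeasure_bounded_finite[of "?W k"] bounded_subset[OF bounded_N_less[of 1], of "?W k"] by auto
  ultimately have "(\<lambda>k. measure lborel (?W k)) \<longlonglongrightarrow> measure lborel (\<Inter>k. ?W k)"
    by (intro Lim_measure_decseq) auto
  also have "measure lborel (\<Inter>k. ?W k) = 0"
  proof -
    have sub: "(\<Inter>k. ?W k) \<subseteq> (\<Union>(a, b)\<in>{(a, b) \<in> A \<times> A. a \<noteq> b}. {x. (a - b) \<bullet> x = 0})"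
    proof
      fix x assume x: "x \<in> (\<Inter>k. ?W k)"
      show "x \<in> (\<Union>(a, b)\<in>{(a, b) \<in> A \<times> A. a \<noteq> b}. {x. (a - b) \<bullet> x = 0})"
      proof (rule ccontr)
        assume *: "\<not> ?thesis"
        then have nz: "0 < \<bar>(fst q - snd q) \<bullet> x\<bar>" if "q \<in> {(a, b) \<in> A \<times> A. a \<noteq> b}" for q
          using that * by (cases q) auto
        have "(\<lambda>k. N x * (1 / real (Suc k))) \<longlonglongrightarrow> N x * 0"
          by (intro tendsto_intros LIMSEQ_Suc[OF lim_1_over_n])
        then have "\<forall>\<^sub>F k in sequentially. \<forall>q\<in>{(a, b) \<in> A \<times> A. a \<noteq> b}.
          N x * (1 / real (Suc k)) < \<bar>(fst q - snd q) \<bullet> x\<bar>"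
          using nz by (intro eventually_ball_finite finite_pairs ballI order_tendstoD(2)[of _ "N x * 0"]) auto
        then obtain k where "\<forall>q\<in>{(a, b) \<in> A \<times> A. a \<noteq> b}.
          N x * (1 / real (Suc k)) < \<bar>(fst q - snd q) \<bullet> x\<bar>"
          by (auto simp: eventually_sequentially)
        moreover have "x \<in> wall_cones (1 / real (Suc k))" using x by blast
        ultimately show False unfolding wall_cones_def by (fastforce simp: mult.commute)
      qed
    qed
    have "negligible (\<Union>q\<in>{(a, b) \<in> A \<times> A. a \<noteq> b}. {x. (fst q - snd q) \<bullet> x = 0})"
      by (intro negligible_Union finite_imageI finite_pairs) (auto intro!: negligible_hyperplane)
    then have "negligible (\<Inter>k. ?W k)"
      by (rule negligible_subset) (use sub in \<open>simp add: case_prod_unfold\<close>)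
    then have "(\<Inter>k. ?W k) \<in> null_sets lebesgue" by (simp add: negligible_iff_null_sets)
    then show ?thesis by (simp add: null_sets_completion_iff measure_eq_0_null_sets)
  qed
  finally show ?thesis .
qed

text \<open>Far out, a slab of fixed width lies inside any given wall cone. A cone of small volume
  is chosen, and \<open>ex_shell_bound\<close> carries the smallness over to the shell.\<close>

lemma measure_shell_walls_tendsto:
  assumes K: "K \<ge> 0"
  shows "(\<lambda>n. measure lborel (shell (real n) K \<inter> walls R) / real n ^ (DIM('a) - 1)) \<longlonglongrightarrow> 0"
proof (rule LIMSEQ_I)
  fix e :: real assume e: "e > 0"
  obtain C where C: "C > 0"
    "\<And>W. W \<in> sets borel \<Longrightarrow> (\<And>x t. t > 0 \<Longrightarrow> t *\<^sub>R x \<in> W \<longleftrightarrow> x \<in> W) \<Longrightarrow>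
      \<forall>\<^sub>F n in sequentially. measure lborel (shell (real n) K \<inter> W)
        \<le> C * real n ^ (DIM('a) - 1) * measure lborel ({x. N x < 1} \<inter> W)"
    using ex_shell_bound[OF K] by blast
  have "(\<lambda>k. C * measure lborel ({x. N x < 1} \<inter> wall_cones (1 / real (Suc k)))) \<longlonglongrightarrow> C * 0"
    by (intro tendsto_intros measure_wall_cones_tendsto)
  then have "\<forall>\<^sub>F k in sequentially. C * measure lborel ({x. N x < 1} \<inter> wall_cones (1 / real (Suc k))) < e"
    by (rule order_tendstoD) (use e in auto)
  then obtain k where k: "C * measure lborel ({x. N x < 1} \<inter> wall_cones (1 / real (Suc k))) < e"
    by (auto simp: eventually_sequentially)
  let ?W = "wall_cones (1 / real (Suc k))"
  have cone: "t *\<^sub>R x \<in> ?W \<longleftrightarrow> x \<in> ?W" if "t > 0" for t x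
  proof -
    have "\<bar>(a - b) \<bullet> (t *\<^sub>R x)\<bar> \<le> 1 / real (Suc k) * N (t *\<^sub>R x)
      \<longleftrightarrow> \<bar>(a - b) \<bullet> x\<bar> \<le> 1 / real (Suc k) * N x" for a b
    proof -
      have "\<bar>(a - b) \<bullet> (t *\<^sub>R x)\<bar> = t * \<bar>(a - b) \<bullet> x\<bar>"
        "1 / real (Suc k) * N (t *\<^sub>R x) = t * (1 / real (Suc k) * N x)"
        using that by (auto simp: N_scale abs_mult)
      then show ?thesis using that by (simp only: mult_le_cancel_left_pos)
    qed
    then show ?thesis unfolding wall_cones_def by (simp only: mem_Collect_eq UN_iff case_prod_unfold)
  qed
  \<comment> \<open>On the shell \<open>N x \<ge> n - K\<close>, so this threshold gives
    \<open>R \<le> N x / Suc k\<close>.\<close>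
  have "\<forall>\<^sub>F n in sequentially. real n \<ge> K + R * real (Suc k)"
    by (rule eventually_ge_at_top[THEN eventually_compose_filterlim, OF filterlim_real_sequentially])
  moreover have "\<forall>\<^sub>F n in sequentially. measure lborel (shell (real n) K \<inter> ?W)
      \<le> C * real n ^ (DIM('a) - 1) * measure lborel ({x. N x < 1} \<inter> ?W)"
    by (rule C(2)) (use cone in auto)
  moreover note eventually_gt_at_top[of 0]
  ultimately
  have "\<forall>\<^sub>F n in sequentially. \<bar>measure lborel (shell (real n) K \<inter> walls R) / real n ^ (DIM('a) - 1)\<bar> < e"
  proof eventually_elim
    case (elim n)
    have "R \<le> 1 / real (Suc k) * N x" if "x \<in> shell (real n) K" for x
    proof -
      have "R * real (Suc k) \<le> N x" using that elim by (auto simp: shell_def)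
      then show ?thesis by (simp add: field_simps)
    qed
    then have "shell (real n) K \<inter> walls R \<subseteq> shell (real n) K \<inter> ?W"
      unfolding walls_def wall_cones_def by fastforce
    then have "measure lborel (shell (real n) K \<inter> walls R) \<le> measure lborel (shell (real n) K \<inter> ?W)"
      by (intro measure_mono_fmeasurable fmeasurableI emeasure_bounded_finite)
        (auto intro: bounded_subset[OF bounded_shell])
    also have "\<dots> \<le> real n ^ (DIM('a) - 1) * (C * measure lborel ({x. N x < 1} \<inter> ?W))"
      using elim by (simp add: algebra_simps)
    also have "\<dots> < real n ^ (DIM('a) - 1) * e"
      using k elim by (intro mult_strict_left_mono) auto
    finally show ?case using elim by (simp add: divide_less_eq mult.commute)
  qed
  then show "\<exists>no. \<forall>n\<ge>no. norm (measure lborel (shell (real n) K \<inter> walls R) / real n ^ (DIM('a) - 1) - 0) < e"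
    by (simp add: eventually_sequentially)
qed

section \<open>Radial projection to the unit sphere of the gauge\<close>

definition proj :: "'a \<Rightarrow> 'a" where
  "proj x = (1 / N x) *\<^sub>R x"

lemma proj_scale: "t > 0 \<Longrightarrow> proj (t *\<^sub>R x) = proj x"
  by (simp add: proj_def N_scale)

lemma proj_measurable [measurable]: "proj \<in> borel_measurable borel"
  unfolding proj_def[abs_def] by measurable

lemma N_proj: "x \<noteq> 0 \<Longrightarrow> N (proj x) = 1"
  using N_pos[of x] by (simp add: proj_def N_scale)

lemma N_proj_le: "N (proj x) \<le> 1"
  using N_proj[of x] by (cases "x = 0") (auto simp: proj_def)

lemma compact_N_le: "compact {x. N x \<le> 1}"
proof -
  have "{x. N x \<le> 1} \<subseteq> {x. N x < 2}" by auto
  then show ?thesis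
    using bounded_subset[OF bounded_N_less] closed_Collect_le[OF continuous_on_N continuous_on_const]
    by (simp add: compact_eq_bounded_closed)
qed

lemma proj_lipschitz:
  obtains C where "C > 0" "\<And>x y. x \<noteq> 0 \<Longrightarrow> norm (proj y - proj x) \<le> C * norm (y - x) / N x"
proof -
  obtain R where R: "R > 0" "\<And>x. norm x \<le> R * N x" using ex_norm_le_N by blast
  obtain c where c: "c > 0" "\<And>x. N x \<le> c * norm x" using ex_N_le_norm by blast
  have "norm (proj y - proj x) \<le> (1 + R * c) * norm (y - x) / N x" if "x \<noteq> 0" for x y
  proof -
    have pos: "N x > 0" using that by (rule N_pos)
    \<comment> \<open>The first summand moves the point at the fixed scale \<open>N x\<close>, the
      second corrects the scale. The case \<open>y = 0\<close> is included because
      \<open>proj 0 = 0\<close>.\<close>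
    have eq: "proj y - proj x = (1 / N x) *\<^sub>R (y - x) + (1 - N y / N x) *\<^sub>R proj y"
    proof (cases "y = 0")
      case False
      then have "N y *\<^sub>R proj y = y" using N_pos[of y] by (simp add: proj_def)
      then have "(N y / N x) *\<^sub>R proj y = (1 / N x) *\<^sub>R y"
        by (metis (no_types) divide_inverse mult.commute mult.left_neutral scaleR_scaleR)
      then show ?thesis by (simp add: proj_def[of x] scaleR_diff_right scaleR_diff_left)
    qed (simp add: proj_def)
    have "norm (proj y) \<le> R" using R(2)[of "proj y"] N_proj_le[of y] R(1)
      by (smt (verit) mult_left_le)
    moreover have "\<bar>1 - N y / N x\<bar> \<le> c * norm (y - x) / N x"
    proof -
      have "\<bar>N x - N y\<bar> \<le> c * norm (y - x)"
        using N_diff_le[of x y] N_diff_le[of y x] c(2)[of "x - y"] c(2)[of "y - x"]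
        by (simp add: norm_minus_commute)
      then have "\<bar>N x - N y\<bar> / N x \<le> c * norm (y - x) / N x"
        using pos by (intro divide_right_mono) auto
      moreover have "1 - N y / N x = (N x - N y) / N x" using pos by (simp add: field_simps)
      ultimately show ?thesis using pos by (simp add: abs_divide)
    qed
    ultimately have "norm ((1 - N y / N x) *\<^sub>R proj y) \<le> (c * norm (y - x) / N x) * R"
      unfolding norm_scaleR using pos c(1) by (intro mult_mono) auto
    then have "norm (proj y - proj x) \<le> norm (y - x) / N x + (c * norm (y - x) / N x) * R"
      unfolding eq using pos by (intro order_trans[OF norm_triangle_ineq] add_mono) auto
    also have "\<dots> = (1 + R * c) * norm (y - x) / N x"
      using pos by (simp add: field_simps)
    finally show ?thesis .
  qed
  moreover have "1 + R * c > 0" using R(1) c(1) by (simp add: add_pos_pos)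
  ultimately show ?thesis using that by blast
qed

lemma uniformly_continuous_on_unit:
  fixes f :: "'a \<Rightarrow> real"
  assumes "continuous_on UNIV f" "e > 0"
  obtains \<delta> where "\<delta> > 0" "\<And>x y. N x \<le> 1 \<Longrightarrow> N y \<le> 1 \<Longrightarrow> norm (x - y) < \<delta> \<Longrightarrow> \<bar>f x - f y\<bar> < e"
proof -
  have "uniformly_continuous_on {x. N x \<le> 1} f"
    using assms(1) compact_N_le by (intro compact_uniformly_continuous) (auto intro: continuous_on_subset)
  then obtain \<delta> where "\<delta> > 0" "\<forall>x\<in>{x. N x \<le> 1}. \<forall>x'\<in>{x. N x \<le> 1}. dist x' x < \<delta> \<longrightarrow> dist (f x') (f x) < e"
    using assms(2) unfolding uniformly_continuous_on_def by blast
  then show ?thesis using that[of \<delta>] by (auto simp: dist_norm)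
qed

text \<open>A fixed shift moves the projection of a point of the shell by O(1/n), and
  \<open>f\<close> is uniformly continuous on the unit ball.\<close>

lemma slowly_varying_proj:
  fixes f :: "'a \<Rightarrow> real"
  assumes f: "continuous_on UNIV f" and e: "e > 0"
  shows "\<forall>\<^sub>F n in sequentially. \<forall>x\<in>shell (real n) K. \<bar>f (proj (x + u)) - f (proj x)\<bar> < e"
proof -
  obtain \<delta> where \<delta>: "\<delta> > 0"
    "\<And>x y. N x \<le> 1 \<Longrightarrow> N y \<le> 1 \<Longrightarrow> norm (x - y) < \<delta> \<Longrightarrow> \<bar>f x - f y\<bar> < e"
    using uniformly_continuous_on_unit[OF f e] by blast
  obtain C where C: "C > 0" "\<And>x y. x \<noteq> 0 \<Longrightarrow> norm (proj y - proj x) \<le> C * norm (y - x) / N x"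
    using proj_lipschitz by blast
  have "\<forall>\<^sub>F n in sequentially. real n > K + C * norm u / \<delta>"
    by (rule eventually_gt_at_top[THEN eventually_compose_filterlim, OF filterlim_real_sequentially])
  then show ?thesis
  proof (eventually_elim, intro ballI)
    fix n x assume "real n > K + C * norm u / \<delta>" "x \<in> shell (real n) K"
    then have *: "C * norm u / \<delta> < N x" by (auto simp: shell_def abs_le_iff)
    moreover have "0 \<le> C * norm u / \<delta>" using C(1) \<delta>(1) by simp
    ultimately have pos: "N x > 0" by linarith
    then have "x \<noteq> 0" by auto
    then have "norm (proj (x + u) - proj x) \<le> C * norm u / N x" using C(2)[of x "x + u"] by simp
    also have "\<dots> < \<delta>" using * pos \<delta>(1) by (simp add: field_simps)
    finally show "\<bar>f (proj (x + u)) - f (proj x)\<bar> < e" using \<delta>(2) N_proj_le by blast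
  qed
qed

section \<open>The cone measure as an image of the uniform measure\<close>

lemma interior_unit: "interior {x. N x \<le> 1} = {x. N x < 1}"
proof (rule antisym)
  show "interior {x. N x \<le> 1} \<subseteq> {x. N x < 1}"
  proof
    fix x assume x: "x \<in> interior {x. N x \<le> 1}"
    then obtain e where e: "e > 0" "ball x e \<subseteq> {x. N x \<le> 1}" by (auto simp: mem_interior)
    show "x \<in> {x. N x < 1}"
    proof (cases "x = 0")
      case False
      \<comment> \<open>Stretching by this \<open>t > 1\<close> keeps \<open>x\<close> inside the
        ball of radius \<open>e\<close> but enlarges \<open>N x\<close>, so \<open>N x = 1\<close>
        is impossible in the interior.\<close>
      define t where "t = 1 + e / (2 * norm x)"
      have "t *\<^sub>R x - x = (e / (2 * norm x)) *\<^sub>R x" by (simp add: t_def scaleR_left_distrib)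
      then have "norm (t *\<^sub>R x - x) = e / 2" using False e(1) by simp
      then have "t *\<^sub>R x \<in> ball x e" using e(1) by (simp add: dist_norm norm_minus_commute)
      then have "t * N x \<le> 1" using e False by (auto simp: t_def N_scale)
      moreover have "1 * N x < t * N x" using False e(1) N_pos[of x]
        by (intro mult_strict_right_mono) (auto simp: t_def)
      ultimately show ?thesis by simp
    qed simp
  qed
  show "{x. N x < 1} \<subseteq> interior {x. N x \<le> 1}"
    by (rule interior_maximal) (auto intro: open_N_less)
qed

lemma frontier_unit: "frontier {x. N x \<le> 1} = {x. N x = 1}"
  using compact_imp_closed[OF compact_N_le] by (auto simp: frontier_def interior_unit)

lemma convex_unit: "convex {x. N x \<le> 1}"
proof -
  have "{x. N x \<le> 1} = (\<Inter>a\<in>A. {x. a \<bullet> x \<le> 1})" by (auto simp: N_le_iff)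
  then show ?thesis by (auto intro!: convex_INT convex_halfspace_le)
qed

lemma negligible_unit_sphere: "negligible {x. N x = 1}"
  using negligible_convex_frontier[OF convex_unit] by (simp add: frontier_unit)

lemma N_less_lmeasurable: "{x. N x < 1} \<inter> proj -` X \<in> lmeasurable" if [measurable]: "X \<in> sets borel"
proof (rule bounded_set_imp_lmeasurable)
  show "bounded ({x. N x < 1} \<inter> proj -` X)" by (rule bounded_subset[OF bounded_N_less]) auto
  have "proj -` X \<in> sets borel" using measurable_sets[OF proj_measurable that] by simp
  then show "{x. N x < 1} \<inter> proj -` X \<in> sets lebesgue" by auto
qed

text \<open>The cone and the radial preimage differ at most at the origin and on the unit sphere, a
  negligible set. Comparing up to null sets spares a separate measurability proof for the
  cone.\<close>

lemma measure_cone_over: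
  assumes X: "X \<in> sets borel"
  shows "measure lebesgue (cone_over (X \<inter> {x. N x = 1})) = measure lborel ({x. N x < 1} \<inter> proj -` X)"
proof -
  let ?Y = "{x. N x < 1} \<inter> proj -` X" and ?T = "cone_over (X \<inter> {x. N x = 1})"
  have "?Y - ?T \<union> (?T - ?Y) \<subseteq> insert 0 {x. N x = 1}"
  proof -
    have "x \<in> ?T" if x: "x \<in> ?Y" "x \<noteq> 0" for x
      unfolding cone_over_def
    proof (intro CollectI exI conjI)
      show "x = N x *\<^sub>R proj x" using N_pos[OF x(2)] by (simp add: proj_def)
      show "proj x \<in> X \<inter> {x. N x = 1}" using x N_proj by auto
    qed (use x N_nonneg in auto)
    moreover have "x \<in> ?Y" if x: "x \<in> ?T" "x \<noteq> 0" "N x \<noteq> 1" for x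
    proof -
      obtain t y where "x = t *\<^sub>R y" "0 \<le> t" "t \<le> 1" "y \<in> X" "N y = 1"
        using x(1) by (auto simp: cone_over_def)
      then show ?thesis using x proj_scale[of t y] by (auto simp: N_scale proj_def)
    qed
    ultimately show ?thesis by blast
  qed
  moreover have "negligible (insert 0 {x. N x = 1})" using negligible_unit_sphere by simp
  ultimately have "negligible (?Y - ?T \<union> (?T - ?Y))" by (rule negligible_subset[rotated])
  from measure_negligible_symdiff[OF N_less_lmeasurable[OF X] this]
  have "measure lebesgue ?T = measure lebesgue ?Y" .
  moreover have "?Y \<in> sets lborel" using measurable_sets[OF proj_measurable X] by auto
  ultimately show ?thesis by simp
qed

lemma measure_unit: "measure lebesgue {x. N x \<le> 1} = measure lborel {x. N x < 1}"
proof -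
  have "{x. N x < 1} - {x. N x \<le> 1} \<union> ({x. N x \<le> 1} - {x. N x < 1}) = {x. N x = 1}" by auto
  then show ?thesis
    using measure_negligible_symdiff[of "{x. N x < 1}" "{x. N x \<le> 1}"] negligible_unit_sphere
      N_less_lmeasurable[of UNIV] by simp
qed

lemma measure_unit_pos: "measure lborel {x. N x < 1} > 0"
proof (rule ccontr)
  assume "\<not> ?thesis"
  then have "measure lborel {x. N x < 1} = 0" using measure_nonneg[of lborel "{x. N x < 1}"] by linarith
  then have "emeasure lborel {x. N x < 1} = 0"
    using finite_measure_N_less[of 1] by (simp add: emeasure_eq_ennreal_measure less_top)
  then have "{x. N x < 1} \<in> null_sets lebesgue"
    by (auto simp: null_sets_completion_iff null_sets_def)
  then have "negligible {x. N x < 1}" by (simp add: negligible_iff_null_sets)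
  moreover have "0 \<in> {x. N x < 1}" by simp
  ultimately show False using open_not_negligible[OF open_N_less[of 1]] by blast
qed

text \<open>The law of the radial projection of a uniform point of the unit ball. As an image
  measure it is countably additive from the start; the set function in \<open>limit_measure\<close>
  inherits this by agreeing with it on Borel sets.\<close>

definition cone_prob :: "'a measure" where
  "cone_prob = distr (uniform_measure lborel {x. N x < 1}) borel proj"

lemma prob_space_cone_prob: "prob_space cone_prob"
proof -
  have "emeasure lborel {x. N x < 1} \<noteq> 0" using measure_unit_pos by (auto simp: measure_def)
  then have "prob_space (uniform_measure lborel {x. N x < 1})"
    using finite_measure_N_less[of 1] by (intro prob_space_uniform_measure) auto
  then show ?thesis unfolding cone_prob_def by (intro prob_space.prob_space_distr) auto
qed

lemma emeasure_cone_prob: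
  assumes X: "X \<in> sets borel"
  shows "emeasure cone_prob X
    = ennreal (cone_measure {x. N x \<le> 1} (X \<inter> frontier {x. N x \<le> 1}))"
proof -
  have pX: "proj -` X \<in> sets borel" using measurable_sets[OF proj_measurable X] by simp
  have fin: "emeasure lborel ({x. N x < 1} \<inter> proj -` X) \<noteq> \<infinity>"
    using emeasure_bounded_finite[OF bounded_subset[OF bounded_N_less[of 1]], of "{x. N x < 1} \<inter> proj -` X"] by auto
  have "emeasure cone_prob X = emeasure lborel ({x. N x < 1} \<inter> proj -` X) / emeasure lborel {x. N x < 1}"
    unfolding cone_prob_def using X pX by (simp add: emeasure_distr)
  also have "\<dots> = ennreal (measure lborel ({x. N x < 1} \<inter> proj -` X) / measure lborel {x. N x < 1})"
    using fin finite_measure_N_less[of 1] measure_unit_pos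
    by (simp add: emeasure_eq_ennreal_measure divide_ennreal less_top)
  finally show ?thesis
    by (simp add: cone_measure_def frontier_unit measure_cone_over[OF X] measure_unit)
qed

lemma integral_cone_prob:
  fixes f :: "'a \<Rightarrow> real"
  assumes [measurable]: "f \<in> borel_measurable borel"
  shows "integral\<^sup>L cone_prob f
    = (\<integral>x. indicator {x. N x < 1} x * f (proj x) \<partial>lborel) / measure lborel {x. N x < 1}"
proof -
  let ?V = "measure lborel {x. N x < 1}"
  have eV: "emeasure lborel {x. N x < 1} = ennreal ?V"
    using finite_measure_N_less[of 1] by (simp add: emeasure_eq_ennreal_measure less_top)
  have "uniform_measure lborel {x. N x < 1} = density lborel (\<lambda>x. ennreal (indicator {x. N x < 1} x / ?V))"
    unfolding uniform_measure_def eV using measure_unit_pos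
    by (intro arg_cong[where f="density lborel"] ext) (auto simp: indicator_def divide_ennreal simp flip: ennreal_1)
  then have "integral\<^sup>L cone_prob f
    = (\<integral>x. f (proj x) \<partial>density lborel (\<lambda>x. ennreal (indicator {x. N x < 1} x / ?V)))"
    unfolding cone_prob_def by (simp add: integral_distr)
  also have "\<dots> = (\<integral>x. (indicator {x. N x < 1} x / ?V) *\<^sub>R f (proj x) \<partial>lborel)"
    by (intro integral_density) auto
  finally show ?thesis by simp
qed

end

section \<open>Integer lengths close to a gauge\<close>

text \<open>A discrete Landau inequality. Over a window of \<open>M\<close> steps the first
  difference is nearly constant, so \<open>M\<close> times its value is close to
  \<open>P (n + M) - P n\<close>, which is of order \<open>n ^ p\<close>. A large fixed
  \<open>M\<close> then makes the difference small.\<close>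

lemma first_difference_tendsto_0:
  fixes P :: "nat \<Rightarrow> real"
  assumes bound: "\<forall>\<^sub>F n in sequentially. \<bar>P n\<bar> \<le> C * real n ^ p"
    and second: "(\<lambda>n. (P (n + 2) - 2 * P (n + 1) + P n) / real n ^ p) \<longlonglongrightarrow> 0"
  shows "(\<lambda>n. (P (n + 1) - P n) / real n ^ p) \<longlonglongrightarrow> 0"
proof (rule LIMSEQ_I)
  fix e :: real assume e: "e > 0"
  define D where "D n = P (n + 1) - P n" for n
  \<comment> \<open>\<open>M\<close> is chosen so that the end terms \<open>P (n + M)\<close> and
    \<open>P n\<close> use up less than half of \<open>e\<close>; \<open>\<delta>\<close> then
    confines the drift within the window to the other half. The factor \<open>2 ^ p\<close> comes
    from \<open>n + k \<le> 2 * n\<close> for \<open>k \<le> M \<le> n\<close>.\<close>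
  obtain M' :: nat where M': "2 * \<bar>C\<bar> * (2 ^ p + 1) / e < M'" using reals_Archimedean2 by blast
  define M where "M = Suc M'"
  have M0: "real M > 0" by (simp add: M_def)
  have "2 * \<bar>C\<bar> * (2 ^ p + 1) / e < M" using M' by (simp add: M_def)
  then have M: "2 * (\<bar>C\<bar> * (2 ^ p + 1)) < e * M" using e by (simp add: field_simps)
  define \<delta> where "\<delta> = e / (2 * M * 2 ^ p)"
  have \<delta>: "\<delta> > 0" using e M0 by (simp add: \<delta>_def)
  obtain n0 where n0: "\<And>n. n \<ge> n0 \<Longrightarrow> \<bar>P n\<bar> \<le> C * real n ^ p"
    using bound by (auto simp: eventually_sequentially)
  obtain n1 where n1: "\<And>n. n \<ge> n1 \<Longrightarrow> \<bar>(P (n + 2) - 2 * P (n + 1) + P n) / real n ^ p\<bar> < \<delta>"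
    using LIMSEQ_D[OF second \<delta>] by auto
  have "\<bar>D n / real n ^ p\<bar> < e" if n: "n \<ge> n0 + n1 + M" for n
  proof -
    have npos: "real n > 0" using n by (simp add: M_def)
    define q where "q = real n ^ p"
    have q: "q > 0" using npos by (simp add: q_def)
    have le2: "real (n + k) ^ p \<le> 2 ^ p * q" if "k \<le> M" for k
    proof -
      have "real (n + k) ^ p \<le> (2 * real n) ^ p" using that n by (intro power_mono) auto
      then show ?thesis by (simp add: power_mult_distrib q_def)
    qed
    have Pn: "\<bar>P (n + k)\<bar> \<le> \<bar>C\<bar> * (2 ^ p * q)" if "k \<le> M" for k
    proof -
      have "\<bar>P (n + k)\<bar> \<le> C * real (n + k) ^ p" using n by (intro n0) auto
      also have "\<dots> \<le> \<bar>C\<bar> * real (n + k) ^ p" by (intro mult_right_mono) auto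
      also have "\<dots> \<le> \<bar>C\<bar> * (2 ^ p * q)" by (intro mult_left_mono le2 that) auto
      finally show ?thesis .
    qed
    have P0: "\<bar>P n\<bar> \<le> \<bar>C\<bar> * q"
    proof -
      have "\<bar>P n\<bar> \<le> C * q" using n0[of n] n by (auto simp: q_def)
      also have "\<dots> \<le> \<bar>C\<bar> * q" using q by (intro mult_right_mono) auto
      finally show ?thesis .
    qed
    have step: "\<bar>D (n + k + 1) - D (n + k)\<bar> \<le> \<delta> * (2 ^ p * q)" if "k \<le> M" for k
    proof -
      have "\<bar>(D (n + k + 1) - D (n + k)) / real (n + k) ^ p\<bar> < \<delta>"
        using n1[of "n + k"] n by (simp add: D_def algebra_simps)
      then have "\<bar>D (n + k + 1) - D (n + k)\<bar> \<le> \<delta> * real (n + k) ^ p"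
        using npos by (simp add: abs_divide divide_less_eq)
      also have "\<dots> \<le> \<delta> * (2 ^ p * q)" using \<delta> by (intro mult_left_mono le2 that) auto
      finally show ?thesis .
    qed
    have Dk: "\<bar>D (n + k) - D n\<bar> \<le> k * (\<delta> * (2 ^ p * q))" if "k \<le> M" for k
      using that
    proof (induction k)
      case (Suc k)
      then show ?case using step[of k] by (simp add: algebra_simps)
    qed simp
    have tele: "P (n + k) - P n = (\<Sum>i<k. D (n + i))" for k
      by (induction k) (auto simp: D_def)
    have "\<bar>(\<Sum>i<M. D (n + i)) - M * D n\<bar> = \<bar>\<Sum>i<M. D (n + i) - D n\<bar>"
      by (simp add: sum_subtractf)
    also have "\<dots> \<le> (\<Sum>i<M. \<bar>D (n + i) - D n\<bar>)" by (rule sum_abs)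
    also have "\<dots> \<le> (\<Sum>i<M. M * (\<delta> * (2 ^ p * q)))"
    proof (intro sum_mono)
      fix i assume "i \<in> {..<M}"
      then have "\<bar>D (n + i) - D n\<bar> \<le> i * (\<delta> * (2 ^ p * q))" by (intro Dk) auto
      also have "\<dots> \<le> M * (\<delta> * (2 ^ p * q))"
        using \<open>i \<in> _\<close> \<delta> q by (intro mult_right_mono) auto
      finally show "\<bar>D (n + i) - D n\<bar> \<le> M * (\<delta> * (2 ^ p * q))" .
    qed
    also have "\<dots> = M * (M * (\<delta> * (2 ^ p * q)))" by simp
    also have "M * (\<delta> * (2 ^ p * q)) = e * q / 2" using M0 by (simp add: \<delta>_def)
    finally have "\<bar>M * D n\<bar> \<le> \<bar>P (n + M)\<bar> + \<bar>P n\<bar> + M * (e * q / 2)"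
      unfolding tele[symmetric] by linarith
    also have "\<dots> \<le> \<bar>C\<bar> * (2 ^ p + 1) * q + M * (e * q / 2)"
      using Pn[of M] P0 by (simp add: algebra_simps)
    also have "\<dots> < e * M / 2 * q + M * (e * q / 2)"
      using M q by (intro add_strict_right_mono mult_strict_right_mono) auto
    also have "\<dots> = M * (e * q)" by (simp add: field_simps)
    finally have "\<bar>D n\<bar> < e * q" using M0 by (simp add: abs_mult)
    then show ?thesis using q by (simp add: abs_divide divide_less_eq q_def)
  qed
  then show "\<exists>no. \<forall>n\<ge>no. norm ((P (n + 1) - P n) / real n ^ p - 0) < e"
    by (auto simp: D_def)
qed

text \<open>\<open>F\<close> lives on the whole space rather than on lattice points, so that moving
  a level by \<open>v a\<close> preserves measure. \<open>F_step\<close> is demanded only at depth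
  \<open>R\<close> inside the cone of \<open>a\<close>, where word length offers it exactly.\<close>

locale coarse_length = gauge A
  for A :: "'a::euclidean_space set" +
  fixes F :: "'a \<Rightarrow> nat" and v :: "'a \<Rightarrow> 'a" and K R :: real
  assumes F_measurable [measurable]: "F \<in> measurable borel (count_space UNIV)"
    and F_near_N: "\<bar>real (F x) - N x\<bar> \<le> K"
    and R_nonneg: "R \<ge> 0"
    and F_step: "a \<in> A \<Longrightarrow> (\<And>b. b \<in> A - {a} \<Longrightarrow> R \<le> (a - b) \<bullet> x) \<Longrightarrow> F (x + v a) = Suc (F x)"
begin

lemma K_nonneg: "K \<ge> 0"
  using F_near_N[of 0] by linarith

definition deep :: "'a \<Rightarrow> 'a set" where
  "deep a = (\<Inter>b\<in>A - {a}. {x. R \<le> (a - b) \<bullet> x})"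

lemma deep_measurable [measurable]: "deep a \<in> sets borel"
proof -
  have "closed (deep a)" unfolding deep_def
    by (intro closed_INT ballI closed_Collect_le continuous_intros)
  then show ?thesis by simp
qed

lemma F_deep: "a \<in> A \<Longrightarrow> x \<in> deep a \<Longrightarrow> F (x + v a) = Suc (F x)"
  by (rule F_step) (auto simp: deep_def)

text \<open>The shift \<open>w = 0\<close> serves the level \<open>n\<close>, and
  \<open>w = v\<close> the translated pieces at \<open>n + 1\<close>. Outside the widened walls the
  functional attaining \<open>N x\<close> leads every other by more than \<open>R + r\<close>, and a
  shift alters each comparison by at most \<open>r\<close>.\<close>

lemma sum_indicator_deep:
  assumes w: "\<And>a b. a \<in> A \<Longrightarrow> b \<in> A \<Longrightarrow> \<bar>(a - b) \<bullet> w a\<bar> \<le> r" and x: "x \<notin> walls (R + r)"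
  shows "(\<Sum>a\<in>A. indicator (deep a) (x - w a)) = (1 :: real)"
proof -
  have far: "R + r < \<bar>(a - b) \<bullet> x\<bar>" if "a \<in> A" "b \<in> A" "a \<noteq> b" for a b
    using x that unfolding walls_def by (force simp: not_le)
  obtain a where a: "a \<in> A" "N x = a \<bullet> x" by (rule N_attained)
  have "indicator (deep b) (x - w b) = (if b = a then 1 else 0 :: real)" if b: "b \<in> A" for b
  proof (cases "b = a")
    case True
    have "R \<le> (a - c) \<bullet> (x - w a)" if "c \<in> A - {a}" for c
    proof -
      have "c \<bullet> x \<le> a \<bullet> x" using that inner_le_N[of c x] a by simp
      then show ?thesis using far[of a c] w[of a c] that a by (auto simp: inner_diff_right inner_diff_left)
    qed
    then show ?thesis using True by (auto simp: deep_def indicator_def)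
  next
    case False
    have "b \<bullet> x \<le> a \<bullet> x" using b inner_le_N[of b x] a by simp
    then have "\<not> R \<le> (b - a) \<bullet> (x - w b)"
      using far[of b a] w[of b a] b a False R_nonneg by (auto simp: inner_diff_right inner_diff_left)
    then show ?thesis using False a by (auto simp: deep_def indicator_def)
  qed
  then show ?thesis using a(1) finite_A by (simp add: sum.delta cong: sum.cong)
qed

lemma level_subset_shell: "{x. F x = n} \<subseteq> shell (real n) K"
  using F_near_N by (auto simp: shell_def abs_minus_commute)

lemma bounded_level: "bounded {x. F x = n}"
  by (rule bounded_subset[OF bounded_shell level_subset_shell])

lemma integrable_level:
  assumes [measurable]: "h \<in> borel_measurable borel" and "\<And>x. \<bar>h x\<bar> \<le> b"
  shows "integrable lborel (\<lambda>x. indicator {x. F x = n} x * (h x :: real))"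
  by (rule integrable_on_bounded_set[where B=b]) (use assms bounded_level in auto)

definition level_integral :: "('a \<Rightarrow> real) \<Rightarrow> nat \<Rightarrow> real" where
  "level_integral g n = (\<integral>x. indicator {x. F x = n} x * g x \<partial>lborel)"

text \<open>In the application \<open>g\<close> is a continuous function composed with
  \<open>proj\<close>. Homogeneity makes its integrals over dilated balls scale exactly; slow
  variation makes a fixed translation harmless.\<close>

context
  fixes g :: "'a \<Rightarrow> real" and B :: real
  assumes g_measurable [measurable]: "g \<in> borel_measurable borel"
    and g_bound: "\<And>x. \<bar>g x\<bar> \<le> B"
    and g_hom: "\<And>x t. t > 0 \<Longrightarrow> g (t *\<^sub>R x) = g x"
    and g_slow: "\<And>u e. e > 0 \<Longrightarrow> \<forall>\<^sub>F n in sequentially. \<forall>x\<in>shell (real n) K. \<bar>g (x + u) - g x\<bar> < e"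
begin

lemma B_nonneg: "B \<ge> 0" using g_bound[of 0] by linarith

text \<open>Off the walls the shifted deep cones partition the level by
  \<open>sum_indicator_deep\<close>; on the walls the defect is at most
  \<open>(1 + card A) * B\<close>.\<close>

lemma level_integral_split:
  fixes w :: "'a \<Rightarrow> 'a"
  assumes w: "\<And>a b. a \<in> A \<Longrightarrow> b \<in> A \<Longrightarrow> \<bar>(a - b) \<bullet> w a\<bar> \<le> r"
    and sub: "{x. F x = n} \<subseteq> shell s K'"
  shows "\<bar>level_integral g n - (\<Sum>a\<in>A. \<integral>x. indicator {x. F x = n} x * (indicator (deep a) (x - w a) * g x) \<partial>lborel)\<bar>
    \<le> (1 + card A) * B * measure lborel (shell s K' \<inter> walls (R + r))"
proof -
  let ?L = "{x. F x = n}"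
  have int: "integrable lborel (\<lambda>x. indicator ?L x * (indicator (deep a) (x - w a) * g x))" for a
    using g_bound B_nonneg by (intro integrable_level[where b=B]) (auto simp: indicator_def)
  let ?h = "\<lambda>x. indicator ?L x * g x - (\<Sum>a\<in>A. indicator ?L x * (indicator (deep a) (x - w a) * g x))"
  have int': "integrable lborel ?h"
    using int integrable_level[of g B n] g_bound by auto
  have "level_integral g n - (\<Sum>a\<in>A. \<integral>x. indicator ?L x * (indicator (deep a) (x - w a) * g x) \<partial>lborel)
      = (\<integral>x. ?h x \<partial>lborel)"
    unfolding level_integral_def using int integrable_level[of g B n] g_bound
    by (subst Bochner_Integration.integral_diff) (auto simp: Bochner_Integration.integral_sum)
  also have "\<bar>\<dots>\<bar> \<le> ((1 + card A) * B) * measure lborel (shell s K' \<inter> walls (R + r))"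
  proof (rule abs_integral_on_le[OF _ _ int'])
    fix x
    have eq: "?h x = indicator ?L x * (1 - (\<Sum>a\<in>A. indicator (deep a) (x - w a))) * g x"
      by (simp add: algebra_simps sum_distrib_left sum_distrib_right)
    show "\<bar>?h x\<bar> \<le> indicator (shell s K' \<inter> walls (R + r)) x * ((1 + card A) * B)"
    proof (cases "x \<in> ?L \<and> x \<in> walls (R + r)")
      case True
      have "0 \<le> (\<Sum>a\<in>A. indicator (deep a) (x - w a) :: real)" by (intro sum_nonneg) auto
      moreover have "(\<Sum>a\<in>A. indicator (deep a) (x - w a) :: real) \<le> (\<Sum>a\<in>A. 1)"
        by (intro sum_mono) (auto simp: indicator_def)
      ultimately have "\<bar>1 - (\<Sum>a\<in>A. indicator (deep a) (x - w a) :: real)\<bar> \<le> 1 + card A" by simp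
      then have "\<bar>1 - (\<Sum>a\<in>A. indicator (deep a) (x - w a))\<bar> * \<bar>g x\<bar> \<le> (1 + card A) * B"
        using g_bound by (intro mult_mono) auto
      then show ?thesis using True sub unfolding eq by (auto simp: abs_mult)
    next
      case False
      then have "?h x = 0" unfolding eq using sum_indicator_deep[OF w] by auto
      then show ?thesis using B_nonneg by (simp add: indicator_def)
    qed
  qed (auto intro: bounded_subset[OF bounded_shell])
  finally show ?thesis .
qed

text \<open>Both levels are cut into deep pieces. The piece at \<open>n + 1\<close> is the translate
  by \<open>v a\<close> of the piece at \<open>n\<close>, so the two integrals differ only through
  \<open>g (x + v a) - g x\<close>, which is small on the shell.\<close>

lemma level_integral_diff_tendsto: "(\<lambda>n. (level_integral g (n + 1) - level_integral g n) / real n ^ (DIM('a) - 1)) \<longlonglongrightarrow> 0"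
proof -
  let ?p = "DIM('a) - 1"
  define r where "r = Max ((\<lambda>(a, b). \<bar>(a - b) \<bullet> v a\<bar>) ` (A \<times> A))"
  have r: "\<bar>(a - b) \<bullet> v a\<bar> \<le> r" if "a \<in> A" "b \<in> A" for a b
    unfolding r_def using that finite_A by (intro Max_ge) auto
  have r0: "\<bar>(a - b) \<bullet> 0\<bar> \<le> r" if "a \<in> A" "b \<in> A" for a b :: 'a
    using r[OF that] by auto
  define I where "I a n = (\<integral>x. indicator {x. F x = n} x * (indicator (deep a) x * g x) \<partial>lborel)" for a n
  define J where "J a n = (\<integral>x. indicator {x. F x = n} x * (indicator (deep a) x * g (x + v a)) \<partial>lborel)" for a n
  \<comment> \<open>The width \<open>K + 1\<close> lets one shell around \<open>n\<close> contain
    both levels \<open>n\<close> and \<open>n + 1\<close>.\<close>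
  let ?w = "\<lambda>n. measure lborel (shell (real n) (K + 1) \<inter> walls (R + r))"
  let ?c = "(1 + card A) * B"
  have 1: "\<bar>level_integral g n - (\<Sum>a\<in>A. I a n)\<bar> \<le> ?c * ?w n" for n
  proof -
    have "shell (real n) K \<subseteq> shell (real n) (K + 1)" by (auto simp: shell_def)
    then show ?thesis
      using level_integral_split[where w="\<lambda>_. 0", OF r0, of n "real n" "K + 1"] level_subset_shell[of n]
      by (auto simp: I_def)
  qed
  have 2: "\<bar>level_integral g (n + 1) - (\<Sum>a\<in>A. J a n)\<bar> \<le> ?c * ?w n" for n
  proof -
    have "J a n = (\<integral>x. indicator {x. F x = n + 1} x * (indicator (deep a) (x - v a) * g x) \<partial>lborel)"
      if a: "a \<in> A" for a
    proof -
      have "(\<integral>x. indicator {x. F x = n + 1} x * (indicator (deep a) (x - v a) * g x) \<partial>lborel)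
        = (\<integral>x. indicator {x. F x = n + 1} x * (indicator (deep a) (x - v a) * g x) \<partial>distr lborel borel ((+) (v a)))"
        by (simp only: lborel_distr_plus)
      also have "\<dots> = (\<integral>x. indicator {x. F x = n + 1} (v a + x) * (indicator (deep a) x * g (v a + x)) \<partial>lborel)"
        by (subst integral_distr) auto
      \<comment> \<open>On \<open>deep a\<close>, \<open>F (v a + x) = n + 1\<close> holds exactly
        when \<open>F x = n\<close>.\<close>
      also have "\<dots> = J a n" unfolding J_def
        using F_deep[OF a] by (intro Bochner_Integration.integral_cong) (auto simp: indicator_def add.commute)
      finally show ?thesis by simp
    qed
    moreover have "shell (real (n + 1)) K \<subseteq> shell (real n) (K + 1)" by (auto simp: shell_def)
    ultimately show ?thesis
      using level_integral_split[where w=v, OF r, of "n + 1" "real n" "K + 1"] level_subset_shell[of "n + 1"]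
      by auto
  qed
  obtain C where C: "C > 0"
    "\<And>W. W \<in> sets borel \<Longrightarrow> (\<And>x t. t > 0 \<Longrightarrow> t *\<^sub>R x \<in> W \<longleftrightarrow> x \<in> W) \<Longrightarrow>
      \<forall>\<^sub>F n in sequentially. measure lborel (shell (real n) K \<inter> W)
        \<le> C * real n ^ (DIM('a) - 1) * measure lborel ({x. N x < 1} \<inter> W)"
    using ex_shell_bound[OF K_nonneg] by blast
  have shell: "\<forall>\<^sub>F n in sequentially. measure lborel (shell (real n) K)
        \<le> C * real n ^ (DIM('a) - 1) * measure lborel {x. N x < 1}"
    using C(2)[of UNIV] by simp
  have 3: "(\<lambda>n. (J a n - I a n) / real n ^ ?p) \<longlonglongrightarrow> 0" if a: "a \<in> A" for a
  proof (rule LIMSEQ_I)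
    fix e :: real assume e: "e > 0"
    define V where "V = measure lborel {x. N x < 1}"
    \<comment> \<open>The added 1 keeps the denominator positive and makes the final comparison
      strict.\<close>
    define \<epsilon> where "\<epsilon> = e / (C * V + 1)"
    have V0: "V \<ge> 0" by (simp add: V_def)
    have CV: "C * V + 1 > 0" using V0 C(1) by (intro add_nonneg_pos) auto
    have \<epsilon>: "\<epsilon> > 0" using e CV by (simp add: \<epsilon>_def)
    have "\<forall>\<^sub>F n in sequentially. \<bar>(J a n - I a n) / real n ^ ?p\<bar> < e"
      using g_slow[OF \<epsilon>, of "v a"] shell eventually_gt_at_top[of 0]
    proof eventually_elim
      case (elim n)
      let ?h = "\<lambda>x. indicator {x. F x = n} x * (indicator (deep a) x * g (x + v a))
        - indicator {x. F x = n} x * (indicator (deep a) x * g x)"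
      have ints: "integrable lborel (\<lambda>x. indicator {x. F x = n} x * (indicator (deep a) x * g (x + v a)))"
        "integrable lborel (\<lambda>x. indicator {x. F x = n} x * (indicator (deep a) x * g x))"
        using g_bound B_nonneg by (intro integrable_level[where b=B]; auto simp: indicator_def)+
      have "\<bar>J a n - I a n\<bar> = \<bar>\<integral>x. ?h x \<partial>lborel\<bar>"
        unfolding J_def I_def using ints by simp
      also have "\<dots> \<le> \<epsilon> * measure lborel (shell (real n) K)"
      proof (rule abs_integral_on_le)
        show "\<bar>?h x\<bar> \<le> indicator (shell (real n) K) x * \<epsilon>" for x
          using elim(1) level_subset_shell[of n] \<epsilon>
          by (cases "x \<in> shell (real n) K") (auto simp: indicator_def intro: less_imp_le)
      qed (use ints bounded_shell in auto)
      also have "\<dots> \<le> \<epsilon> * (C * real n ^ ?p * V)"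
        using elim(2) \<epsilon> by (intro mult_left_mono) (auto simp: V_def)
      also have "\<dots> = \<epsilon> * (C * V) * real n ^ ?p" by simp
      also have "\<dots> < \<epsilon> * (C * V + 1) * real n ^ ?p"
        using \<epsilon> elim(3) by (intro mult_strict_right_mono) auto
      also have "\<epsilon> * (C * V + 1) = e" using CV by (simp add: \<epsilon>_def)
      finally show ?case using elim(3) by (simp add: abs_divide divide_less_eq)
    qed
    then show "\<exists>no. \<forall>n\<ge>no. norm ((J a n - I a n) / real n ^ ?p - 0) < e"
      by (simp add: eventually_sequentially)
  qed
  have "(\<lambda>n. (\<Sum>a\<in>A. (J a n - I a n) / real n ^ ?p)) \<longlonglongrightarrow> (\<Sum>a\<in>A. 0)"
    by (intro tendsto_sum 3)
  then have 4: "(\<lambda>n. \<bar>\<Sum>a\<in>A. (J a n - I a n) / real n ^ ?p\<bar> + 2 * ?c * (?w n / real n ^ ?p)) \<longlonglongrightarrow> \<bar>0\<bar> + 2 * ?c * 0"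
    using K_nonneg by (intro tendsto_intros measure_shell_walls_tendsto) auto
  show ?thesis
  proof (rule Lim_null_comparison)
    show "\<forall>\<^sub>F n in sequentially. norm ((level_integral g (n + 1) - level_integral g n) / real n ^ ?p)
      \<le> \<bar>\<Sum>a\<in>A. (J a n - I a n) / real n ^ ?p\<bar> + 2 * ?c * (?w n / real n ^ ?p)"
    proof (rule always_eventually, rule allI)
      fix n
      have "\<bar>level_integral g (n + 1) - level_integral g n\<bar> \<le> \<bar>(\<Sum>a\<in>A. J a n) - (\<Sum>a\<in>A. I a n)\<bar> + 2 * (?c * ?w n)"
        using 1[of n] 2[of n] by linarith
      then have "\<bar>level_integral g (n + 1) - level_integral g n\<bar> / real n ^ ?p
          \<le> (\<bar>(\<Sum>a\<in>A. J a n) - (\<Sum>a\<in>A. I a n)\<bar> + 2 * (?c * ?w n)) / real n ^ ?p"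
        by (rule divide_right_mono) simp
      then show "norm ((level_integral g (n + 1) - level_integral g n) / real n ^ ?p)
        \<le> \<bar>\<Sum>a\<in>A. (J a n - I a n) / real n ^ ?p\<bar> + 2 * ?c * (?w n / real n ^ ?p)"
        by (simp add: abs_divide add_divide_distrib sum_subtractf flip: sum_divide_distrib)
    qed
  qed (use 4 in simp)
qed

text \<open>\<open>P\<close> is the discrepancy between the balls of \<open>F\<close> and of
  \<open>N\<close>, and its first difference is the level integral minus its predicted value.
  \<open>first_difference_tendsto_0\<close> thus shows that the prediction is right to leading
  order.\<close>

lemma level_integral_tendsto:
  "(\<lambda>n. level_integral g n / real n ^ (DIM('a) - 1))
    \<longlonglongrightarrow> DIM('a) * (\<integral>x. indicator {x. N x < 1} x * g x \<partial>lborel)"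
proof -
  let ?p = "DIM('a) - 1" and ?d = "DIM('a)"
  define c where "c = (\<integral>x. indicator {x. N x < 1} x * g x \<partial>lborel)"
  \<comment> \<open>The strict inequality \<open>F x < n\<close> makes
    \<open>P (n + 1) - P n\<close> pick up the level \<open>n\<close> itself. By homogeneity the
    subtracted term is the integral of \<open>g\<close> over \<open>{x. N x < n}\<close>.\<close>
  define P where "P n = (\<integral>x. indicator {x. F x < n} x * g x \<partial>lborel) - real n ^ ?d * c" for n
  define h where "h n = ((real n + 1) ^ ?d - (real n + 0) ^ ?d) / real n ^ ?p" for n
  have h: "h \<longlonglongrightarrow> ?d" unfolding h_def using tendsto_power_diff[of ?d 1 0] by simp
  have bounded_ball: "bounded {x. F x < n}" for n
  proof (rule bounded_subset[OF bounded_N_less])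
    have "N x < real n + K" if "F x < n" for x using F_near_N[of x] that by linarith
    then show "{x. F x < n} \<subseteq> {x. N x < real n + K}" by auto
  qed
  have int: "integrable lborel (\<lambda>x. indicator {x. F x < n} x * g x)" for n
    using bounded_ball g_bound by (intro integrable_on_bounded_set[where B=B]) auto
  have intN: "integrable lborel (\<lambda>x. indicator {x. N x < t} x * g x)" for t
    using bounded_N_less g_bound by (intro integrable_on_bounded_set[where B=B]) auto
  have diff: "P (n + 1) - P n = level_integral g n - ((real n + 1) ^ ?d - real n ^ ?d) * c" for n
  proof -
    have "(\<integral>x. indicator {x. F x < n + 1} x * g x \<partial>lborel)
      = (\<integral>x. indicator {x. F x < n} x * g x + indicator {x. F x = n} x * g x \<partial>lborel)"
      by (intro Bochner_Integration.integral_cong) (auto simp: indicator_def)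
    also have "\<dots> = (\<integral>x. indicator {x. F x < n} x * g x \<partial>lborel) + level_integral g n"
      unfolding level_integral_def using int integrable_level[of g B n] g_bound by simp
    finally show ?thesis by (simp add: P_def algebra_simps)
  qed
  obtain C where C: "C > 0"
    "\<And>W. W \<in> sets borel \<Longrightarrow> (\<And>x t. t > 0 \<Longrightarrow> t *\<^sub>R x \<in> W \<longleftrightarrow> x \<in> W) \<Longrightarrow>
      \<forall>\<^sub>F n in sequentially. measure lborel (shell (real n) K \<inter> W)
        \<le> C * real n ^ (DIM('a) - 1) * measure lborel ({x. N x < 1} \<inter> W)"
    using ex_shell_bound[OF K_nonneg] by blast
  have "\<forall>\<^sub>F n in sequentially. measure lborel (shell (real n) K)
        \<le> C * real n ^ ?p * measure lborel {x. N x < 1}"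
    using C(2)[of UNIV] by simp
  then have bound: "\<forall>\<^sub>F n in sequentially. \<bar>P n\<bar> \<le> (B * C * measure lborel {x. N x < 1}) * real n ^ ?p"
    using eventually_gt_at_top[of 0]
  proof eventually_elim
    case (elim n)
    let ?h = "\<lambda>x. indicator {x. F x < n} x * g x - indicator {x. N x < real n} x * g x"
    have "real n ^ ?d * c = (\<integral>x. indicator {x. N x < real n} x * g x \<partial>lborel)"
      unfolding c_def using elim g_hom by (subst integral_N_less) auto
    then have "\<bar>P n\<bar> = \<bar>\<integral>x. ?h x \<partial>lborel\<bar>"
      unfolding P_def using int intN by simp
    also have "\<dots> \<le> B * measure lborel (shell (real n) K)"
    proof (rule abs_integral_on_le)
      fix x
      have "x \<in> shell (real n) K" if "(F x < n) \<noteq> (N x < real n)"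
        using that F_near_N[of x] by (auto simp: shell_def)
      then show "\<bar>?h x\<bar> \<le> indicator (shell (real n) K) x * B"
        using g_bound[of x] B_nonneg by (auto simp: indicator_def)
    qed (use int intN bounded_shell in auto)
    also have "\<dots> \<le> B * (C * real n ^ ?p * measure lborel {x. N x < 1})"
      using elim B_nonneg by (intro mult_left_mono) auto
    finally show ?case by (simp add: algebra_simps)
  qed
  have h1: "(\<lambda>n. h (n + 1)) \<longlonglongrightarrow> ?d" using LIMSEQ_ignore_initial_segment[OF h, of 1] by simp
  \<comment> \<open>\<open>h (n + 1)\<close> is normalised by the power of \<open>n + 1\<close>,
    whereas the second difference is divided by the power of \<open>n\<close>.\<close>
  have ratio: "(\<lambda>n. real (n + 1) ^ ?p / real n ^ ?p) \<longlonglongrightarrow> 1"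
  proof -
    have "(\<lambda>n. (1 + 1 / real n) ^ ?p) \<longlonglongrightarrow> (1 + 0) ^ ?p"
      by (intro tendsto_intros lim_1_over_n)
    moreover have "\<forall>\<^sub>F n in sequentially. (1 + 1 / real n) ^ ?p = real (n + 1) ^ ?p / real n ^ ?p"
      using eventually_gt_at_top[of 0]
    proof eventually_elim
      case (elim n)
      then have "1 + 1 / real n = real (n + 1) / real n" by (simp add: field_simps)
      then show ?case by (simp only: power_divide)
    qed
    ultimately show ?thesis
      using Lim_transform_eventually by fastforce
  qed
  \<comment> \<open>Both \<open>h\<close> terms tend to the dimension, so the second difference of
    \<open>real n ^ ?d\<close> is negligible against \<open>real n ^ ?p\<close>.\<close>
  have "(\<lambda>n. (level_integral g (n + 1) - level_integral g n) / real n ^ ?p - (h (n + 1) * (real (n + 1) ^ ?p / real n ^ ?p) - h n) * c)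
    \<longlonglongrightarrow> 0 - (real ?d * 1 - real ?d) * c"
    by (rule tendsto_diff[OF level_integral_diff_tendsto tendsto_mult[OF tendsto_diff[OF tendsto_mult[OF h1 ratio] h] tendsto_const]])
  moreover have "\<forall>\<^sub>F n in sequentially.
      (level_integral g (n + 1) - level_integral g n) / real n ^ ?p - (h (n + 1) * (real (n + 1) ^ ?p / real n ^ ?p) - h n) * c
      = (P (n + 2) - 2 * P (n + 1) + P n) / real n ^ ?p"
    using eventually_gt_at_top[of 0]
  proof eventually_elim
    case (elim n)
    have "P (n + 2) - 2 * P (n + 1) + P n = (P (n + 1 + 1) - P (n + 1)) - (P (n + 1) - P n)" by simp
    also have "\<dots> = (level_integral g (n + 1) - level_integral g n)
        - (((real (n + 1) + 1) ^ ?d - real (n + 1) ^ ?d) - ((real n + 1) ^ ?d - real n ^ ?d)) * c"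
      unfolding diff by (simp add: algebra_simps)
    also have "(real (n + 1) + 1) ^ ?d - real (n + 1) ^ ?d = h (n + 1) * real (n + 1) ^ ?p"
      by (simp add: h_def)
    also have "(real n + 1) ^ ?d - real n ^ ?d = h n * real n ^ ?p"
      using elim by (simp add: h_def)
    finally have eq: "P (n + 2) - 2 * P (n + 1) + P n
      = level_integral g (n + 1) - level_integral g n - (h (n + 1) * real (n + 1) ^ ?p - h n * real n ^ ?p) * c" .
    have "real n ^ ?p \<noteq> 0" using elim by simp
    then show ?case unfolding eq by (simp only: diff_divide_distrib times_divide_eq_right
        times_divide_eq_left left_diff_distrib nonzero_mult_div_cancel_right mult.assoc mult.commute[of "real n ^ ?p" c])
      (use elim in simp)
  qed
  ultimately have "(\<lambda>n. (P (n + 2) - 2 * P (n + 1) + P n) / real n ^ ?p) \<longlonglongrightarrow> 0"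
    using Lim_transform_eventually by fastforce
  from first_difference_tendsto_0[OF bound this]
  have "(\<lambda>n. (P (n + 1) - P n) / real n ^ ?p + h n * c) \<longlonglongrightarrow> 0 + ?d * c"
    by (intro tendsto_intros h)
  moreover have "(P (n + 1) - P n) / real n ^ ?p + h n * c = level_integral g n / real n ^ ?p" for n
    unfolding diff h_def by (simp add: diff_divide_distrib add_divide_distrib algebra_simps)
  ultimately show ?thesis by (simp add: c_def)
qed

end

end

section \<open>Word length on the integer lattice\<close>

lemma of_lattice_nth [simp]: "of_lattice w $ i = real_of_int (w $ i)"
  by (simp add: of_lattice_def)

lemma of_lattice_0 [simp]: "of_lattice 0 = 0"
  by (simp add: vec_eq_iff)

lemma of_lattice_add: "of_lattice (v + w) = of_lattice v + of_lattice w"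
  by (simp add: vec_eq_iff)

lemma of_lattice_minus: "of_lattice (- w) = - of_lattice w"
  by (simp add: vec_eq_iff)

lemma of_lattice_diff: "of_lattice (v - w) = of_lattice v - of_lattice w"
  by (simp add: vec_eq_iff)

lemma of_lattice_eq_iff: "of_lattice v = of_lattice w \<longleftrightarrow> v = w"
  by (simp add: vec_eq_iff)

lemma inj_on_of_lattice: "inj_on of_lattice X"
  by (simp add: inj_on_def of_lattice_eq_iff)

lemma finite_lattice_ball: "finite {w :: int ^ 'n. norm (of_lattice w) \<le> B}"
proof -
  let ?I = "{- \<lceil>B\<rceil>..\<lceil>B\<rceil>}"
  have "finite (vec_lambda ` (UNIV \<rightarrow>\<^sub>E ?I) :: (int ^ 'n) set)"
    by (intro finite_imageI finite_PiE) auto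
  moreover have "{w :: int ^ 'n. norm (of_lattice w) \<le> B} \<subseteq> vec_lambda ` (UNIV \<rightarrow>\<^sub>E ?I)"
  proof
    fix w :: "int ^ 'n" assume w: "w \<in> {w. norm (of_lattice w) \<le> B}"
    have "w $ i \<in> ?I" for i
    proof -
      have "\<bar>of_lattice w $ i\<bar> \<le> B" using component_le_norm_cart[of "of_lattice w" i] w by simp
      then show ?thesis by simp linarith
    qed
    then show "w \<in> vec_lambda ` (UNIV \<rightarrow>\<^sub>E ?I)"
      by (intro image_eqI[of _ _ "vec_nth w"]) (auto simp: vec_nth_inverse)
  qed
  ultimately show ?thesis by (rule finite_subset[rotated])
qed

text \<open>Rounding down splits the space into half-open unit cubes and commutes with lattice
  translations.\<close>

definition floor_vec :: "real ^ 'n \<Rightarrow> int ^ 'n" where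
  "floor_vec x = (\<chi> i. \<lfloor>x $ i\<rfloor>)"

lemma floor_vec_add_lattice: "floor_vec (x + of_lattice w) = floor_vec x + w"
  by (simp add: floor_vec_def vec_eq_iff)

lemma norm_diff_floor_vec: "norm (of_lattice (floor_vec x) - x) \<le> CARD('n)" for x :: "real ^ 'n"
proof -
  have "norm (of_lattice (floor_vec x) - x) \<le> (\<Sum>i\<in>UNIV. \<bar>(of_lattice (floor_vec x) - x) $ i\<bar>)"
    by (rule norm_le_l1_cart)
  also have "\<dots> \<le> (\<Sum>i\<in>(UNIV :: 'n set). 1)"
    by (intro sum_mono) (simp add: floor_vec_def, linarith)
  finally show ?thesis by simp
qed

lemma floor_vec_vimage_measurable [measurable]: "{x. floor_vec x = w} \<in> sets borel"
proof -
  have "{x. floor_vec x = w} = (\<Inter>i. {x. \<lfloor>x $ i\<rfloor> = w $ i})"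
    by (auto simp: floor_vec_def vec_eq_iff)
  also have "\<dots> \<in> sets borel" by measurable
  finally show ?thesis .
qed

text \<open>The half-open cube lies between an open and a closed box, both of volume 1.\<close>

lemma measure_unit_cube: "measure lborel {x. floor_vec x = w} = 1"
proof -
  let ?l = "of_lattice w" and ?u = "of_lattice w + 1"
  have b: "(?u - ?l) \<bullet> b = 1" if "b \<in> Basis" for b
    using that by (auto simp: Basis_vec_def inner_axis)
  have le: "?l \<bullet> b \<le> ?u \<bullet> b" if "b \<in> Basis" for b
    using b[OF that] by (simp add: inner_diff_left inner_add_left)
  have "emeasure lborel (box ?l ?u) = 1" "emeasure lborel (cbox ?l ?u) = 1"
    using le b by (simp_all add: emeasure_lborel_box emeasure_lborel_cbox)
  moreover have "box ?l ?u \<subseteq> {x. floor_vec x = w}" "{x. floor_vec x = w} \<subseteq> cbox ?l ?u"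
    by (auto simp: mem_box_cart floor_vec_def vec_eq_iff floor_eq_iff less_imp_le)
  then have "emeasure lborel (box ?l ?u) \<le> emeasure lborel {x. floor_vec x = w}"
    "emeasure lborel {x. floor_vec x = w} \<le> emeasure lborel (cbox ?l ?u)"
    by (auto intro!: emeasure_mono)
  ultimately show ?thesis by (simp add: measure_def)
qed

section \<open>Generating sets of the lattice and the gauge of their polytope\<close>

locale lattice_gens =
  fixes S :: "(int ^ 'n) set"
  assumes finite_S: "finite S" and sym: "symmetric_set S" and gen: "generating_set S"
begin

sublocale word_gens S
  using sym gen by unfold_locales

text \<open>\<open>S\<close> spans the space, because the standard basis vectors are sums of
  generators.\<close>

lemma inner_gens_eq_0:
  assumes "\<And>s. s \<in> S \<Longrightarrow> a \<bullet> of_lattice s = 0"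
  shows "a = 0"
proof -
  have "a \<bullet> of_lattice w = 0" for w
  proof -
    obtain ws where ws: "set ws \<subseteq> S" "sum_list ws = w" using ex_word by blast
    have "a \<bullet> of_lattice (sum_list ws) = 0"
      using ws(1) assms by (induction ws) (auto simp: of_lattice_add inner_add_right)
    then show ?thesis using ws by simp
  qed
  moreover have "of_lattice (axis i 1) = axis i (1 :: real)" for i
    by (simp add: vec_eq_iff axis_def)
  ultimately have "a \<bullet> axis i 1 = 0" for i by metis
  then show ?thesis by (simp add: vec_eq_iff inner_axis)
qed

text \<open>By symmetry the origin is interior: if a bounding halfspace
  \<open>a \<bullet> x \<le> b\<close> had \<open>b \<le> 0\<close>, applying it to \<open>s\<close>
  and \<open>- s\<close> would give \<open>a \<bullet> s = 0\<close> for all generators and hence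
  \<open>a = 0\<close>. So \<open>b > 0\<close>, and every inequality can be divided by it.\<close>

lemma ex_halfspaces: "\<exists>A. finite A \<and> word_polytope S = {x. \<forall>a\<in>A. a \<bullet> x \<le> 1}"
proof -
  have "polyhedron (word_polytope S)"
    unfolding word_polytope_def using finite_S by (intro polyhedron_convex_hull) auto
  then obtain H where H: "finite H" "word_polytope S = \<Inter>H"
    "\<forall>h\<in>H. \<exists>a b. a \<noteq> 0 \<and> h = {x. a \<bullet> x \<le> b}"
    unfolding polyhedron_def by auto
  then obtain a b where ab: "\<And>h. h \<in> H \<Longrightarrow> a h \<noteq> 0 \<and> h = {x. a h \<bullet> x \<le> b h}"
    by metis
  have in_hull: "a h \<bullet> of_lattice s \<le> b h" if "h \<in> H" "s \<in> S" for h s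
  proof -
    have "of_lattice s \<in> word_polytope S" unfolding word_polytope_def using that by (intro hull_inc) auto
    then show ?thesis using H(2) ab[OF that(1)] that(1) by blast
  qed
  have pos: "b h > 0" if h: "h \<in> H" for h
  proof (rule ccontr)
    assume "\<not> b h > 0"
    then have "a h \<bullet> of_lattice s = 0" if "s \<in> S" for s
      using in_hull[OF h that] in_hull[OF h uminus_mem[OF that]] by (simp add: of_lattice_minus)
    then have "a h = 0" by (rule inner_gens_eq_0)
    then show False using ab[OF h] by simp
  qed
  have "h = {x. ((1 / b h) *\<^sub>R a h) \<bullet> x \<le> 1}" if "h \<in> H" for h
  proof -
    have "{x. ((1 / b h) *\<^sub>R a h) \<bullet> x \<le> 1} = {x. a h \<bullet> x \<le> b h}"
      using pos[OF that] by simp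
    then show ?thesis using ab[OF that] by metis
  qed
  then have "word_polytope S = {x. \<forall>a\<in>(\<lambda>h. (1 / b h) *\<^sub>R a h) ` H. a \<bullet> x \<le> 1}"
    unfolding H(2) by blast
  moreover have "finite ((\<lambda>h. (1 / b h) *\<^sub>R a h) ` H)" using H(1) by (rule finite_imageI)
  ultimately show ?thesis by (intro exI conjI)
qed

definition halfspaces :: "(real ^ 'n) set" where
  "halfspaces = (SOME A. finite A \<and> word_polytope S = {x. \<forall>a\<in>A. a \<bullet> x \<le> 1})"

lemma halfspaces: "finite halfspaces" "word_polytope S = {x. \<forall>a\<in>halfspaces. a \<bullet> x \<le> 1}"
  unfolding halfspaces_def using someI_ex[OF ex_halfspaces] by auto

lemma compact_polytope: "compact (word_polytope S)"
  unfolding word_polytope_def using finite_S by (intro finite_imp_compact_convex_hull) auto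

sublocale gauge halfspaces
proof
  show "bounded {x. \<forall>a\<in>halfspaces. a \<bullet> x \<le> 1}"
    using compact_polytope unfolding halfspaces(2) by (rule compact_imp_bounded)
qed (rule halfspaces)

lemma polytope_eq: "word_polytope S = {x. N x \<le> 1}"
  by (simp add: halfspaces(2) N_le_iff)

lemma N_gen_le: "s \<in> S \<Longrightarrow> N (of_lattice s) \<le> 1"
  using polytope_eq unfolding word_polytope_def by (metis (mono_tags, lifting) hull_inc imageI mem_Collect_eq)

lemma N_le_word_length: "N (of_lattice w) \<le> word_length S w"
proof -
  obtain ws where ws: "set ws \<subseteq> S" "length ws = word_length S w" "sum_list ws = w"
    by (rule geodesic)
  have "N (of_lattice (sum_list ws)) \<le> length ws"
    using ws(1)
  proof (induction ws)
    case (Cons s ws)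
    then show ?case
      using N_gen_le[of s] N_add[of "of_lattice s" "of_lattice (sum_list ws)"] by (simp add: of_lattice_add)
  qed simp
  then show ?thesis using ws by simp
qed

lemma finite_word_sphere: "finite (word_sphere S n)"
proof -
  obtain R where R: "R > 0" "\<And>x. norm x \<le> R * N x" using ex_norm_le_N by blast
  have "norm (of_lattice w) \<le> R * n" if "word_length S w = n" for w
  proof -
    have "norm (of_lattice w) \<le> R * N (of_lattice w)" by (rule R)
    also have "\<dots> \<le> R * n" using N_le_word_length[of w] that R(1) by simp
    finally show ?thesis .
  qed
  then show ?thesis
    by (intro finite_subset[OF _ finite_lattice_ball[of "R * n"]]) (auto simp: word_sphere_def)
qed

text \<open>The vector with all entries \<open>m\<close> has norm at least \<open>m\<close>, hence
  gauge and word length at least \<open>n\<close>; descent does the rest.\<close>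

lemma word_sphere_neq_empty: "word_sphere S n \<noteq> {}"
proof -
  obtain C where C: "C > 0" "\<And>x. norm x \<le> C * N x" using ex_norm_le_N by blast
  obtain m :: nat where m: "C * n \<le> m" using real_arch_simple by blast
  have "real m \<le> norm (of_lattice (\<chi> i. int m) :: real ^ 'n)"
    using component_le_norm_cart[of "of_lattice (\<chi> i. int m) :: real ^ 'n"] by simp
  then have "C * n \<le> C * N (of_lattice (\<chi> i. int m) :: real ^ 'n)"
    using m C(2)[of "of_lattice (\<chi> i. int m)"] by linarith
  then have "n \<le> N (of_lattice (\<chi> i. int m) :: real ^ 'n)" using C(1) by simp
  also note N_le_word_length
  finally have "n \<le> word_length S (\<chi> i. int m)" by simp
  then show ?thesis by (rule word_sphere_nonempty)
qed

section \<open>Decomposition of lattice points along a face\<close>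

definition face_gens :: "real ^ 'n \<Rightarrow> (int ^ 'n) set" where
  "face_gens a = {s \<in> S. a \<bullet> of_lattice s = 1}"

lemma face_gens_subset: "face_gens a \<subseteq> S" and finite_face_gens: "finite (face_gens a)"
  using finite_S by (auto simp: face_gens_def)

text \<open>\<open>x\<close> is scaled to gauge 1 and written as a convex combination of generators.
  Since \<open>a\<close> is at most 1 on each of them and averages to 1, no weight falls outside the
  face.\<close>

lemma cone_representation:
  assumes a: "a \<in> halfspaces" and x: "N x = a \<bullet> x"
  obtains r where "\<And>s. r s \<ge> 0" "x = (\<Sum>s\<in>face_gens a. r s *\<^sub>R of_lattice s)"
    "N x = (\<Sum>s\<in>face_gens a. r s)"
proof (cases "x = 0")
  case True
  then show ?thesis by (intro that[of "\<lambda>_. 0"]) auto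
next
  case False
  then have pos: "N x > 0" by (rule N_pos)
  then have "(1 / N x) *\<^sub>R x \<in> word_polytope S"
    unfolding polytope_eq by (simp add: N_scale)
  then obtain u where u: "\<forall>y\<in>of_lattice ` S. 0 \<le> u y" "sum u (of_lattice ` S) = 1"
    "(\<Sum>y\<in>of_lattice ` S. u y *\<^sub>R y) = (1 / N x) *\<^sub>R x"
    unfolding word_polytope_def using finite_S by (auto simp: convex_hull_finite)
  define t where "t s = u (of_lattice s)" for s
  have t: "\<And>s. s \<in> S \<Longrightarrow> 0 \<le> t s" "sum t S = 1" "(\<Sum>s\<in>S. t s *\<^sub>R of_lattice s) = (1 / N x) *\<^sub>R x"
    using u by (auto simp: t_def sum.reindex[OF inj_on_of_lattice])
  have le1: "a \<bullet> of_lattice s \<le> 1" if "s \<in> S" for s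
    using inner_le_N[OF a, of "of_lattice s"] N_gen_le[OF that] by linarith
  have "a \<bullet> ((1 / N x) *\<^sub>R x) = 1" using pos x by simp
  then have "(\<Sum>s\<in>S. t s * (1 - a \<bullet> of_lattice s)) = 0"
    unfolding t(3)[symmetric] using t(2) by (simp add: inner_sum_right algebra_simps sum_subtractf)
  then have "t s * (1 - a \<bullet> of_lattice s) = 0" if "s \<in> S" for s
    using that t(1) le1 finite_S by (subst (asm) sum_nonneg_eq_0_iff) auto
  then have t0: "t s = 0" if "s \<in> S - face_gens a" for s
    using that by (force simp: face_gens_def)
  have t': "sum t (face_gens a) = 1" "(\<Sum>s\<in>face_gens a. t s *\<^sub>R of_lattice s) = (1 / N x) *\<^sub>R x"
    using t(2,3) sum.mono_neutral_left[OF finite_S face_gens_subset, of a t]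
      sum.mono_neutral_left[OF finite_S face_gens_subset, of a "\<lambda>s. t s *\<^sub>R of_lattice s"] t0 by auto
  define r where "r s = (if s \<in> S then N x * t s else 0)" for s
  have "(\<Sum>s\<in>face_gens a. r s) = N x * (\<Sum>s\<in>face_gens a. t s)"
    unfolding sum_distrib_left r_def using face_gens_subset by (intro sum.cong) auto
  moreover have "(\<Sum>s\<in>face_gens a. r s *\<^sub>R of_lattice s) = N x *\<^sub>R (\<Sum>s\<in>face_gens a. t s *\<^sub>R of_lattice s)"
    unfolding scaleR_sum_right r_def using face_gens_subset by (intro sum.cong) auto
  ultimately show ?thesis
    using pos t(1) t' by (intro that[of r]) (auto simp: r_def)
qed

text \<open>A chosen halfspace may be redundant and touch no generator. A nonzero point where
  \<open>a\<close> attains the gauge excludes this, as an empty sum could not represent it.\<close>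

lemma face_gens_nonempty: "a \<in> halfspaces \<Longrightarrow> N x = a \<bullet> x \<Longrightarrow> x \<noteq> 0 \<Longrightarrow> face_gens a \<noteq> {}"
  by (rule cone_representation[of a x]) auto

lemma word_with_multiplicities:
  assumes "finite T"
  obtains us where "set us \<subseteq> T" "length us = (\<Sum>s\<in>T. m s)"
    "of_lattice (sum_list us) = (\<Sum>s\<in>T. real (m s) *\<^sub>R of_lattice s)"
proof -
  have rep: "of_lattice (sum_list (replicate k s)) = real k *\<^sub>R of_lattice s" for k and s :: "int ^ 'k"
    by (induction k) (auto simp: of_lattice_add scaleR_left_distrib)
  have "\<exists>us. set us \<subseteq> T \<and> length us = (\<Sum>s\<in>T. m s) \<and>
    of_lattice (sum_list us) = (\<Sum>s\<in>T. real (m s) *\<^sub>R of_lattice s)"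
    using assms
  proof (induction T)
    case (insert s T)
    then obtain us where "set us \<subseteq> T" "length us = (\<Sum>s\<in>T. m s)"
      "of_lattice (sum_list us) = (\<Sum>s\<in>T. real (m s) *\<^sub>R of_lattice s)" by auto
    then show ?case using insert rep[of "m s" s]
      by (intro exI[of _ "replicate (m s) s @ us"]) (auto simp: of_lattice_add simp del: sum_list_replicate)
  qed auto
  then show ?thesis using that by blast
qed

text \<open>The bound depends neither on the face nor on the point decomposed, so one finite set
  serves all roundings.\<close>

definition remainders :: "(int ^ 'n) set" where
  "remainders = {e. norm (of_lattice e) \<le> (\<Sum>s\<in>S. norm (of_lattice s))}"

lemma finite_remainders: "finite remainders"
  unfolding remainders_def by (rule finite_lattice_ball)

text \<open>The conic coefficients are rounded down. The integer parts spell the word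
  \<open>us\<close>; the fractional parts leave a vector that is short, and integral as a difference
  of lattice points.\<close>

lemma lattice_decomposition:
  assumes a: "a \<in> halfspaces" and w: "N (of_lattice w) = a \<bullet> of_lattice w"
  obtains e us where "e \<in> remainders" "set us \<subseteq> face_gens a" "w = e + sum_list us"
    "length us \<le> N (of_lattice w)"
proof -
  obtain r where r: "\<And>s. r s \<ge> 0" "of_lattice w = (\<Sum>s\<in>face_gens a. r s *\<^sub>R of_lattice s)"
    "N (of_lattice w) = (\<Sum>s\<in>face_gens a. r s)"
    using cone_representation[OF a w] by blast
  obtain us where us: "set us \<subseteq> face_gens a" "length us = (\<Sum>s\<in>face_gens a. nat \<lfloor>r s\<rfloor>)"
    "of_lattice (sum_list us) = (\<Sum>s\<in>face_gens a. real (nat \<lfloor>r s\<rfloor>) *\<^sub>R of_lattice s)"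
    using word_with_multiplicities[OF finite_face_gens] by blast
  have frac: "0 \<le> r s - real (nat \<lfloor>r s\<rfloor>)" "r s - real (nat \<lfloor>r s\<rfloor>) \<le> 1" for s
    using r(1)[of s] by linarith+
  have "of_lattice (w - sum_list us) = (\<Sum>s\<in>face_gens a. (r s - real (nat \<lfloor>r s\<rfloor>)) *\<^sub>R of_lattice s)"
    unfolding of_lattice_diff r(2) us(3) by (simp add: scaleR_left_diff_distrib sum_subtractf)
  also have "norm \<dots> \<le> (\<Sum>s\<in>face_gens a. norm (of_lattice s))"
  proof (rule sum_norm_le)
    show "norm ((r s - real (nat \<lfloor>r s\<rfloor>)) *\<^sub>R of_lattice s) \<le> norm (of_lattice s)" for s
      using frac[of s] by (simp add: mult_left_le_one_le)
  qed
  also have "\<dots> \<le> (\<Sum>s\<in>S. norm (of_lattice s))"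
    using finite_S face_gens_subset by (intro sum_mono2) auto
  finally have "w - sum_list us \<in> remainders" by (simp add: remainders_def)
  moreover have "real (length us) \<le> N (of_lattice w)"
    unfolding us(2) r(3) of_nat_sum using frac(1) by (intro sum_mono) (simp add: le_diff_eq)
  ultimately show ?thesis using us(1) by (intro that[of "w - sum_list us" us]) auto
qed

text \<open>For the upper bound, a geodesic for one of finitely many remainders is joined to
  \<open>us\<close>, whose length is at most the gauge. The lower bound is
  \<open>N_le_word_length\<close>.\<close>

lemma word_length_near_N:
  obtains C where "\<And>w. \<bar>real (word_length S w) - N (of_lattice w)\<bar> \<le> C"
proof -
  have "\<bar>real (word_length S w) - N (of_lattice w)\<bar> \<le> Max (word_length S ` remainders)" for w
  proof -
    obtain a where a: "a \<in> halfspaces" "N (of_lattice w) = a \<bullet> of_lattice w" by (rule N_attained)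
    then obtain e us where e: "e \<in> remainders" "set us \<subseteq> face_gens a" "w = e + sum_list us"
      "length us \<le> N (of_lattice w)" using lattice_decomposition by blast
    have "word_length S (sum_list us) \<le> length us"
      using e(2) face_gens_subset by (intro word_length_le) auto
    moreover have "word_length S e \<le> Max (word_length S ` remainders)"
      using e(1) finite_remainders by (intro Max_ge) auto
    ultimately have "word_length S w \<le> Max (word_length S ` remainders) + length us"
      using word_length_add[of e "sum_list us"] e(3) by simp
    then show ?thesis using e(4) N_le_word_length[of w] by linarith
  qed
  then show ?thesis using that by blast
qed

text \<open>\<open>c\<close> is a multiple of the sum of the face generators beyond which lengths
  add exactly. A point of the cone with apex \<open>c\<close> is \<open>e + c\<close> plus a word
  over the face, and \<open>s\<close> is one more letter of that word.\<close>

lemma word_length_step: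
  assumes a: "a \<in> halfspaces"
  obtains c where "\<And>w s. N (of_lattice (w - c)) = a \<bullet> of_lattice (w - c) \<Longrightarrow> s \<in> face_gens a \<Longrightarrow>
    word_length S (w + s) = Suc (word_length S w)"
proof -
  have below: "a \<bullet> of_lattice w \<le> word_length S w" for w
    using inner_le_N[OF a, of "of_lattice w"] N_le_word_length[of w] by linarith
  obtain k :: nat where k: "\<And>e us. e \<in> remainders \<Longrightarrow> set us \<subseteq> face_gens a \<Longrightarrow>
    word_length S (e + (\<Sum>i<k. \<Sum>(face_gens a)) + sum_list us)
      = word_length S (e + (\<Sum>i<k. \<Sum>(face_gens a))) + length us"
  proof (rule eventually_additive_length[OF finite_face_gens face_gens_subset finite_remainders])
    show "a \<bullet> of_lattice (x + y) = a \<bullet> of_lattice x + a \<bullet> of_lattice y" for x y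
      by (simp add: of_lattice_add inner_add_right)
    show "a \<bullet> of_lattice s = 1" if "s \<in> face_gens a" for s
      using that by (simp add: face_gens_def)
  qed (use below in blast)+
  let ?c = "\<Sum>i<k. \<Sum>(face_gens a)"
  show ?thesis
  proof (rule that[of ?c])
    fix w s assume w: "N (of_lattice (w - ?c)) = a \<bullet> of_lattice (w - ?c)" and s: "s \<in> face_gens a"
    obtain e us where e: "e \<in> remainders" "set us \<subseteq> face_gens a" "w - ?c = e + sum_list us"
      by (rule lattice_decomposition[OF a w])
    have w_eq: "w = e + ?c + sum_list us" using e(3) by (simp add: algebra_simps)
    have ws_eq: "w + s = e + ?c + sum_list (us @ [s])" by (simp add: w_eq algebra_simps)
    show "word_length S (w + s) = Suc (word_length S w)"
      unfolding ws_eq using e s by (subst k) (auto simp: w_eq k simp del: sum_list_append sum_constant)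
  qed
qed

text \<open>Constant on unit cubes, so that sums over spheres become integrals over levels.\<close>

definition real_length :: "real ^ 'n \<Rightarrow> nat" where
  "real_length x = word_length S (floor_vec x)"

lemma real_length_measurable [measurable]: "real_length \<in> measurable borel (count_space UNIV)"
proof (rule measurableI)
  show "real_length -` X \<inter> space borel \<in> sets borel" for X
  proof -
    have "real_length -` X = (\<Union>n\<in>X. \<Union>w\<in>word_sphere S n. {x. floor_vec x = w})"
      by (auto simp: real_length_def word_sphere_def)
    also have "\<dots> \<in> sets borel"
      by (intro sets.countable_UN' sets.finite_UN finite_word_sphere) auto
    finally show ?thesis by simp
  qed
qed auto

lemma real_length_near_N: obtains K where "\<And>x. \<bar>real (real_length x) - N x\<bar> \<le> K"
proof -
  obtain C where C: "\<And>w. \<bar>real (word_length S w) - N (of_lattice w)\<bar> \<le> C"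
    using word_length_near_N by blast
  obtain c where c: "c > 0" "\<And>x. N x \<le> c * norm x" using ex_N_le_norm by blast
  have "\<bar>real (real_length x) - N x\<bar> \<le> C + c * CARD('n)" for x
  proof -
    let ?w = "of_lattice (floor_vec x)"
    have "c * norm (?w - x) \<le> c * CARD('n)"
      using norm_diff_floor_vec[of x] c(1) by (intro mult_left_mono) auto
    then have "N (?w - x) \<le> c * CARD('n)" "N (x - ?w) \<le> c * CARD('n)"
      using c(2)[of "?w - x"] c(2)[of "x - ?w"] by (auto simp: norm_minus_commute)
    then have "\<bar>N ?w - N x\<bar> \<le> c * CARD('n)" using N_diff_le[of x ?w] N_diff_le[of ?w x] by linarith
    then show ?thesis using C[of "floor_vec x"] unfolding real_length_def by linarith
  qed
  then show ?thesis using that by blast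
qed

text \<open>The choice is meaningful only if the face carries a generator;
  \<open>real_length_step\<close> derives this from the existence of a deep point.\<close>

definition face_gen :: "real ^ 'n \<Rightarrow> real ^ 'n" where
  "face_gen a = of_lattice (SOME s. s \<in> face_gens a)"

lemma real_length_step:
  obtains R where "R > 0" "\<And>a x. a \<in> halfspaces \<Longrightarrow> (\<And>b. b \<in> halfspaces - {a} \<Longrightarrow> R \<le> (a - b) \<bullet> x)
    \<Longrightarrow> real_length (x + face_gen a) = Suc (real_length x)"
proof -
  have "\<exists>c. \<forall>w s. N (of_lattice (w - c)) = a \<bullet> of_lattice (w - c) \<longrightarrow> s \<in> face_gens a \<longrightarrow>
    word_length S (w + s) = Suc (word_length S w)" if "a \<in> halfspaces" for a
    using word_length_step[OF that] by metis
  then obtain c where c: "\<And>a w s. a \<in> halfspaces \<Longrightarrow>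
    N (of_lattice (w - c a)) = a \<bullet> of_lattice (w - c a) \<Longrightarrow> s \<in> face_gens a \<Longrightarrow>
    word_length S (w + s) = Suc (word_length S w)" by metis
  \<comment> \<open>\<open>r (a, b)\<close> bounds the change of \<open>(a - b) \<bullet> x\<close>
    when \<open>x\<close> is rounded to the lattice and moved by the apex \<open>c a\<close>. The
    sum over all pairs is a crude maximum, and the added 1 makes \<open>R\<close> positive.\<close>
  define r where "r = (\<lambda>(a, b). norm (a - b) * (real CARD('n) + norm (of_lattice (c a))))"
  define R where "R = 1 + sum r (halfspaces \<times> halfspaces)"
  have r_nonneg: "r q \<ge> 0" for q unfolding r_def by (auto split: prod.split)
  have r_le: "r (a, b) \<le> R" if "a \<in> halfspaces" "b \<in> halfspaces" for a b
  proof -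
    have "r (a, b) \<le> sum r (halfspaces \<times> halfspaces)"
      using that finite_A r_nonneg by (intro member_le_sum) auto
    then show ?thesis by (simp add: R_def)
  qed
  have R: "R > 0" unfolding R_def using r_nonneg by (intro add_pos_nonneg sum_nonneg) auto
  have "real_length (x + face_gen a) = Suc (real_length x)"
    if a: "a \<in> halfspaces" and x: "\<And>b. b \<in> halfspaces - {a} \<Longrightarrow> R \<le> (a - b) \<bullet> x" for a x
  proof -
    define z where "z = of_lattice (floor_vec x - c a)"
    have "N z = a \<bullet> z"
    proof (rule N_eqI[OF a])
      fix b assume b: "b \<in> halfspaces"
      show "b \<bullet> z \<le> a \<bullet> z"
      proof (cases "b = a")
        case False
        have xz: "x - z = (x - of_lattice (floor_vec x)) + of_lattice (c a)"
          by (simp add: z_def of_lattice_diff)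
        have "norm (x - z) \<le> CARD('n) + norm (of_lattice (c a))"
          unfolding xz using norm_diff_floor_vec[of x] norm_triangle_ineq[of "x - of_lattice (floor_vec x)" "of_lattice (c a)"]
          by (simp add: norm_minus_commute)
        then have "\<bar>(a - b) \<bullet> (x - z)\<bar> \<le> norm (a - b) * (CARD('n) + norm (of_lattice (c a)))"
          by (intro order_trans[OF Cauchy_Schwarz_ineq2] mult_left_mono) auto
        then have "\<bar>(a - b) \<bullet> (x - z)\<bar> \<le> r (a, b)"
          by (simp add: r_def)
        then show ?thesis using r_le[OF a b] x[of b] b False
          by (auto simp: inner_diff_left inner_diff_right)
      qed simp
    qed
    moreover have "face_gens a \<noteq> {}"
    proof -
      \<comment> \<open>With a single functional \<open>N\<close> would be linear, against its
        positivity at both \<open>1\<close> and \<open>- 1\<close>. A second functional makes the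
        depth condition nonvacuous, whence \<open>x \<noteq> 0\<close>.\<close>
      have "halfspaces \<noteq> {a}"
      proof
        assume single: "halfspaces = {a}"
        have "N y = a \<bullet> y" for y
          by (rule N_attained[of y]) (metis single singletonD)
        then show False using N_pos[of 1] N_pos[of "- 1"] by simp
      qed
      then obtain b where "b \<in> halfspaces" "b \<noteq> a" using a by blast
      then have "R \<le> (a - b) \<bullet> x" using x by blast
      then have "x \<noteq> 0" using R by auto
      moreover have "N x = a \<bullet> x"
        using a x R by (intro N_eqI) (auto simp: inner_diff_left, smt (verit) Diff_iff singletonD)
      ultimately show ?thesis using face_gens_nonempty a by blast
    qed
    then have "(SOME s. s \<in> face_gens a) \<in> face_gens a" by (simp add: some_in_eq)
    ultimately show ?thesis
      unfolding real_length_def face_gen_def floor_vec_add_lattice z_def by (intro c[OF a])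
  qed
  then show ?thesis using R that by blast
qed

lemma ex_coarse_length: obtains K R where "coarse_length halfspaces real_length face_gen K R"
proof -
  obtain K where "\<And>x. \<bar>real (real_length x) - N x\<bar> \<le> K" using real_length_near_N by blast
  moreover obtain R where "R > 0" "\<And>a x. a \<in> halfspaces \<Longrightarrow>
    (\<And>b. b \<in> halfspaces - {a} \<Longrightarrow> R \<le> (a - b) \<bullet> x)
    \<Longrightarrow> real_length (x + face_gen a) = Suc (real_length x)" using real_length_step by blast
  ultimately have "coarse_length halfspaces real_length face_gen K R"
    by unfold_locales auto
  then show ?thesis using that by blast
qed

end

section \<open>Convergence of the sphere measures\<close>

context lattice_gens
begin

text \<open>Each lattice point is spread over its cube, which has volume 1.\<close>

lemma sum_sphere_eq_integral:
  fixes \<phi> :: "int ^ 'n \<Rightarrow> real"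
  shows "integrable lborel (\<lambda>x. indicator {x. real_length x = n} x * \<phi> (floor_vec x))"
    and "(\<Sum>w\<in>word_sphere S n. \<phi> w)
      = (\<integral>x. indicator {x. real_length x = n} x * \<phi> (floor_vec x) \<partial>lborel)"
proof -
  have eq: "indicator {x. real_length x = n} x * \<phi> (floor_vec x)
    = (\<Sum>w\<in>word_sphere S n. indicator {x. floor_vec x = w} x * \<phi> w)" for x
  proof -
    have "(\<Sum>w\<in>word_sphere S n. indicator {x. floor_vec x = w} x * \<phi> w)
      = (\<Sum>w\<in>word_sphere S n. if w = floor_vec x then \<phi> w else 0)"
      by (intro sum.cong) (auto simp: indicator_def)
    then show ?thesis using finite_word_sphere[of n]
      by (simp add: indicator_def real_length_def word_sphere_def)
  qed
  have fin: "emeasure lborel {x. floor_vec x = w} < \<infinity>" for w :: "int ^ 'n"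
    using measure_unit_cube[of w] by (metis ennreal_top_neq_one infinity_ennreal_def measure_def
      enn2real_top less_top zero_neq_one)
  have int: "integrable lborel (\<lambda>x. indicator {x. floor_vec x = w} x * \<phi> w)" for w :: "int ^ 'n"
    using fin[of w] by (intro integrable_mult_left) auto
  show "integrable lborel (\<lambda>x. indicator {x. real_length x = n} x * \<phi> (floor_vec x))"
    unfolding eq using int by (intro Bochner_Integration.integrable_sum)
  show "(\<Sum>w\<in>word_sphere S n. \<phi> w)
      = (\<integral>x. indicator {x. real_length x = n} x * \<phi> (floor_vec x) \<partial>lborel)"
    unfolding eq using int by (subst Bochner_Integration.integral_sum) (auto simp: measure_unit_cube)
qed

lemma rescaled_lattice_near_proj:
  fixes K :: real
  assumes K: "\<And>x. \<bar>real (real_length x) - N x\<bar> \<le> K"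
  obtains C where "C > 0" "\<And>n x. real_length x = n \<Longrightarrow> real n > K \<Longrightarrow>
    norm ((1 / real n) *\<^sub>R of_lattice (floor_vec x) - proj x) \<le> C / real n"
proof -
  obtain R where R: "R > 0" "\<And>x. norm x \<le> R * N x" using ex_norm_le_N by blast
  have K0: "K \<ge> 0" using K[of 0] by linarith
  have "norm ((1 / real n) *\<^sub>R of_lattice (floor_vec x) - proj x) \<le> (CARD('n) + R * K) / real n"
    if x: "real_length x = n" and n: "real n > K" for n x
  proof -
    have near: "\<bar>N x - real n\<bar> \<le> K" using K[of x] x by (simp add: abs_minus_commute)
    then have pos: "N x > 0" "real n > 0" using n K0 by linarith+
    \<comment> \<open>The first summand is the rounding error, at most \<open>CARD('n)\<close>
      before rescaling; the second is the mismatch between the scales \<open>n\<close> and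
      \<open>N x\<close>, which differ by at most \<open>K\<close>.\<close>
    have "(1 / real n) *\<^sub>R of_lattice (floor_vec x) - proj x
      = (1 / real n) *\<^sub>R (of_lattice (floor_vec x) - x) + ((1 / real n) - 1 / N x) *\<^sub>R x"
      by (simp add: proj_def scaleR_diff_right scaleR_diff_left)
    also have "norm \<dots> \<le> CARD('n) / real n + R * K / real n"
    proof (intro order_trans[OF norm_triangle_ineq] add_mono)
      show "norm ((1 / real n) *\<^sub>R (of_lattice (floor_vec x) - x)) \<le> CARD('n) / real n"
        using norm_diff_floor_vec[of x] pos by (simp add: divide_right_mono)
      have "1 / real n - 1 / N x = (N x - real n) / (real n * N x)"
        using pos by (simp add: field_simps)
      then have "norm ((1 / real n - 1 / N x) *\<^sub>R x) = \<bar>N x - real n\<bar> * norm x / (real n * N x)"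
        using pos by (simp add: abs_divide abs_mult)
      also have "\<dots> \<le> K * (R * N x) / (real n * N x)"
        using near R pos K0 by (intro divide_right_mono mult_mono) auto
      also have "\<dots> = R * K / real n" using pos by (simp add: field_simps)
      finally show "norm ((1 / real n - 1 / N x) *\<^sub>R x) \<le> R * K / real n" .
    qed
    finally show ?thesis by (simp add: add_divide_distrib)
  qed
  moreover have "CARD('n) + R * K > 0" using R(1) K0 by (intro add_pos_nonneg) auto
  ultimately show ?thesis using that by blast
qed

text \<open>\<open>level_integral_tendsto\<close> applies to \<open>f\<close> composed with
  \<open>proj\<close>. Replacing its value at \<open>x\<close> by \<open>f\<close> at the rescaled
  lattice point costs little, since the two arguments are O(1/n) apart.\<close>

lemma sphere_sum_tendsto:
  fixes f :: "real ^ 'n \<Rightarrow> real"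
  assumes f: "continuous_on UNIV f" and B: "\<And>x. \<bar>f x\<bar> \<le> B"
  shows "(\<lambda>n. (\<Sum>w\<in>word_sphere S n. f ((1 / real n) *\<^sub>R of_lattice w)) / real n ^ (DIM(real ^ 'n) - 1))
    \<longlonglongrightarrow> DIM(real ^ 'n) * (\<integral>x. indicator {x. N x < 1} x * f (proj x) \<partial>lborel)"
proof -
  let ?p = "DIM(real ^ 'n) - 1"
  obtain K R where "coarse_length halfspaces real_length face_gen K R" using ex_coarse_length by blast
  then interpret cl: coarse_length halfspaces real_length face_gen K R .
  have [measurable]: "f \<in> borel_measurable borel"
    using f by (rule borel_measurable_continuous_onI)
  define g where "g x = f (proj x)" for x
  have g_meas [measurable]: "g \<in> borel_measurable borel" unfolding g_def by measurable
  have g_B: "\<bar>g x\<bar> \<le> B" for x by (simp add: g_def B)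
  have lim: "(\<lambda>n. cl.level_integral g n / real n ^ ?p)
    \<longlonglongrightarrow> DIM(real ^ 'n) * (\<integral>x. indicator {x. N x < 1} x * g x \<partial>lborel)"
  proof (rule cl.level_integral_tendsto[OF g_meas g_B])
    show "g (t *\<^sub>R x) = g x" if "t > 0" for t x using that by (simp add: g_def proj_scale)
    show "\<forall>\<^sub>F n in sequentially. \<forall>x\<in>shell (real n) K. \<bar>g (x + u) - g x\<bar> < e" if "e > 0" for u e
      unfolding g_def using slowly_varying_proj[OF f that] by simp
  qed
  let ?s = "\<lambda>n. \<Sum>w\<in>word_sphere S n. f ((1 / real n) *\<^sub>R of_lattice w)"
  have "(\<lambda>n. (?s n - cl.level_integral g n) / real n ^ ?p) \<longlonglongrightarrow> 0"
  proof (rule LIMSEQ_I)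
    fix e :: real assume e: "e > 0"
    obtain C where C: "C > 0"
      "\<And>W. W \<in> sets borel \<Longrightarrow> (\<And>x t. t > 0 \<Longrightarrow> t *\<^sub>R x \<in> W \<longleftrightarrow> x \<in> W) \<Longrightarrow>
        \<forall>\<^sub>F n in sequentially. measure lborel (shell (real n) K \<inter> W)
          \<le> C * real n ^ ?p * measure lborel ({x. N x < 1} \<inter> W)"
      using ex_shell_bound[OF cl.K_nonneg] by blast
    define V where "V = measure lborel {x. N x < 1}"
    have CV: "C * V > 0" using C(1) measure_unit_pos by (simp add: V_def)
    define \<epsilon> where "\<epsilon> = e / (2 * (C * V))"
    have \<epsilon>: "\<epsilon> > 0" using e CV by (simp add: \<epsilon>_def)
    obtain \<delta> where \<delta>: "\<delta> > 0"
      "\<And>x y. N x \<le> 1 \<Longrightarrow> N y \<le> 1 \<Longrightarrow> norm (x - y) < \<delta> \<Longrightarrow> \<bar>f x - f y\<bar> < \<epsilon>"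
      using uniformly_continuous_on_unit[OF f \<epsilon>] by blast
    obtain c where c: "c > 0" "\<And>n x. real_length x = n \<Longrightarrow> real n > K \<Longrightarrow>
      norm ((1 / real n) *\<^sub>R of_lattice (floor_vec x) - proj x) \<le> c / real n"
      using rescaled_lattice_near_proj[OF cl.F_near_N] by blast
    have "\<forall>\<^sub>F n in sequentially. measure lborel (shell (real n) K) \<le> C * real n ^ ?p * V"
      using C(2)[of UNIV] by (simp add: V_def)
    moreover have "\<forall>\<^sub>F n in sequentially. real n > K + c / \<delta>"
      by (rule eventually_gt_at_top[THEN eventually_compose_filterlim, OF filterlim_real_sequentially])
    ultimately have "\<forall>\<^sub>F n in sequentially. \<bar>(?s n - cl.level_integral g n) / real n ^ ?p\<bar> < e"
    proof eventually_elim
      case (elim n)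
      have "c / \<delta> > 0" using c(1) \<delta>(1) by simp
      then have n: "real n > K" "real n > c / \<delta>" "real n > 0" using elim(2) cl.K_nonneg by linarith+
      have close: "\<bar>f ((1 / real n) *\<^sub>R of_lattice (floor_vec x)) - g x\<bar> < \<epsilon>" if x: "real_length x = n" for x
      proof -
        \<comment> \<open>Uniform continuity is available on the unit ball only; the rescaled point
          lies in it because word length dominates the gauge.\<close>
        have "N (of_lattice (floor_vec x)) \<le> real n"
          using N_le_word_length[of "floor_vec x"] x by (simp add: real_length_def)
        then have "N ((1 / real n) *\<^sub>R of_lattice (floor_vec x)) \<le> 1" using n by (simp add: N_scale)
        moreover have "c / real n < \<delta>" using n \<delta>(1) by (simp add: field_simps)
        then have "norm ((1 / real n) *\<^sub>R of_lattice (floor_vec x) - proj x) < \<delta>"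
          using c(2)[OF x n(1)] by linarith
        ultimately show ?thesis unfolding g_def using \<delta>(2) N_proj_le by blast
      qed
      let ?\<phi> = "\<lambda>w. f ((1 / real n) *\<^sub>R of_lattice w)"
      let ?h = "\<lambda>x. indicator {x. real_length x = n} x * ?\<phi> (floor_vec x)
        - indicator {x. real_length x = n} x * g x"
      have ints: "integrable lborel (\<lambda>x. indicator {x. real_length x = n} x * ?\<phi> (floor_vec x))"
        "integrable lborel (\<lambda>x. indicator {x. real_length x = n} x * g x)"
        using sum_sphere_eq_integral(1)[where \<phi>="?\<phi>"] cl.integrable_level[OF g_meas g_B] by auto
      have "\<bar>?s n - cl.level_integral g n\<bar> = \<bar>\<integral>x. ?h x \<partial>lborel\<bar>"
        unfolding cl.level_integral_def sum_sphere_eq_integral(2)[where \<phi>="?\<phi>"] using ints by simp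
      also have "\<dots> \<le> \<epsilon> * measure lborel (shell (real n) K)"
      proof (rule abs_integral_on_le)
        show "\<bar>?h x\<bar> \<le> indicator (shell (real n) K) x * \<epsilon>" for x
          using close[of x] cl.level_subset_shell[of n] \<epsilon>
          by (auto simp: indicator_def intro: less_imp_le)
      qed (use ints bounded_shell in auto)
      also have "\<dots> \<le> \<epsilon> * (C * real n ^ ?p * V)"
        using elim(1) \<epsilon> by (intro mult_left_mono) auto
      also have "\<dots> = (\<epsilon> * (C * V)) * real n ^ ?p" by simp
      also have "\<epsilon> * (C * V) = e / 2" using CV by (auto simp: \<epsilon>_def)
      also have "e / 2 * real n ^ ?p < e * real n ^ ?p"
        using e n(3) by (intro mult_strict_right_mono) auto
      finally show ?case using n(3) by (simp add: abs_divide divide_less_eq)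
    qed
    then show "\<exists>no. \<forall>n\<ge>no. norm ((?s n - cl.level_integral g n) / real n ^ ?p - 0) < e"
      by (simp add: eventually_sequentially)
  qed
  from tendsto_add[OF this lim] show ?thesis by (simp add: g_def diff_divide_distrib)
qed

text \<open>The constant function 1 gives the asymptotics of the cardinality; in the quotient the
  powers of \<open>n\<close> and the dimension cancel.\<close>

lemma sphere_average_tendsto:
  fixes f :: "real ^ 'n \<Rightarrow> real"
  assumes f: "continuous_on UNIV f" and B: "\<And>x. \<bar>f x\<bar> \<le> B"
  shows "(\<lambda>n. (\<Sum>w\<in>word_sphere S n. f ((1 / real n) *\<^sub>R of_lattice w)) / card (word_sphere S n))
    \<longlonglongrightarrow> integral\<^sup>L cone_prob f"
proof -
  let ?p = "DIM(real ^ 'n) - 1" and ?V = "measure lborel {x. N x < 1}"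
  have [measurable]: "f \<in> borel_measurable borel"
    using f by (rule borel_measurable_continuous_onI)
  have "(\<lambda>n. card (word_sphere S n) / real n ^ ?p) \<longlonglongrightarrow> DIM(real ^ 'n) * ?V"
    using sphere_sum_tendsto[of "\<lambda>_. 1" 1] by simp
  moreover have "DIM(real ^ 'n) * ?V \<noteq> 0" using measure_unit_pos by simp
  ultimately have lim: "(\<lambda>n. (\<Sum>w\<in>word_sphere S n. f ((1 / real n) *\<^sub>R of_lattice w)) / real n ^ ?p
      / (card (word_sphere S n) / real n ^ ?p))
    \<longlonglongrightarrow> DIM(real ^ 'n) * (\<integral>x. indicator {x. N x < 1} x * f (proj x) \<partial>lborel) / (DIM(real ^ 'n) * ?V)"
    by (intro tendsto_divide sphere_sum_tendsto[OF f B])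
  have limit: "DIM(real ^ 'n) * (\<integral>x. indicator {x. N x < 1} x * f (proj x) \<partial>lborel) / (DIM(real ^ 'n) * ?V)
      = integral\<^sup>L cone_prob f"
    by (subst integral_cone_prob) auto
  have "\<forall>\<^sub>F n in sequentially.
      (\<Sum>w\<in>word_sphere S n. f ((1 / real n) *\<^sub>R of_lattice w)) / real n ^ ?p
        / (card (word_sphere S n) / real n ^ ?p)
      = (\<Sum>w\<in>word_sphere S n. f ((1 / real n) *\<^sub>R of_lattice w)) / card (word_sphere S n)"
    using eventually_gt_at_top[of 0] by eventually_elim simp
  from Lim_transform_eventually[OF lim this] show ?thesis by (simp only: limit)
qed

text \<open>The image form makes countable additivity and total mass 1 evident; injectivity of the
  rescaling matches it with the counting formula.\<close>

lemma sphere_measure_eq: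
  "sphere_measure S n
    = distr (uniform_count_measure (word_sphere S n)) borel (\<lambda>w. (1 / real n) *\<^sub>R of_lattice w)"
proof -
  let ?U = "uniform_count_measure (word_sphere S n)"
  let ?r = "\<lambda>w :: int ^ 'n. (1 / real n) *\<^sub>R of_lattice w"
  let ?M = "distr ?U borel ?r"
  have inj: "inj_on ?r (word_sphere S n)"
  \<comment> \<open>For \<open>n = 0\<close> rescaling sends everything to 0, but the sphere of
    radius 0 contains no point other than 0.\<close>
  proof (cases "n = 0")
    case True
    then have "word_sphere S n \<subseteq> {0}" by (auto simp: word_sphere_def word_length_eq_0_iff)
    then show ?thesis by (rule inj_on_subset[rotated]) simp
  qed (auto simp: inj_on_def of_lattice_eq_iff)
  have "emeasure ?M X = ennreal (real (card ((*\<^sub>R) (1 / real n) ` of_lattice ` word_sphere S n \<inter> X))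
      / real (card (word_sphere S n)))" if X: "X \<in> sets borel" for X
  proof -
    have im: "(*\<^sub>R) (1 / real n) ` of_lattice ` word_sphere S n \<inter> X = ?r ` {w \<in> word_sphere S n. ?r w \<in> X}"
      by auto
    have "card (?r ` {w \<in> word_sphere S n. ?r w \<in> X}) = card {w \<in> word_sphere S n. ?r w \<in> X}"
      by (intro card_image inj_on_subset[OF inj]) auto
    moreover have "emeasure ?M X = emeasure ?U {w \<in> word_sphere S n. ?r w \<in> X}"
      using X by (subst emeasure_distr)
        (auto simp: space_uniform_count_measure Int_def conj_commute
          intro!: arg_cong[where f="emeasure _"])
    moreover have "emeasure ?U {w \<in> word_sphere S n. ?r w \<in> X}
      = ennreal (card {w \<in> word_sphere S n. ?r w \<in> X} / card (word_sphere S n))"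
      by (intro emeasure_uniform_count_measure finite_word_sphere) auto
    ultimately show ?thesis unfolding im by simp
  qed
  then have "sphere_measure S n = measure_of (space ?M) (sets ?M) (emeasure ?M)"
    unfolding sphere_measure_def space_distr sets_distr space_borel
    by (intro measure_of_eq) (auto simp: sets.sigma_sets_eq[of borel, simplified])
  then show ?thesis by (simp only: measure_of_of_measure)
qed

lemma limit_measure_eq: "limit_measure S = cone_prob"
proof -
  have sets: "sets cone_prob = sets borel" "space cone_prob = UNIV" by (auto simp: cone_prob_def)
  have "limit_measure S = measure_of (space cone_prob) (sets cone_prob) (emeasure cone_prob)"
    unfolding limit_measure_def sets polytope_eq
    by (intro measure_of_eq) (auto simp: emeasure_cone_prob sets.sigma_sets_eq[of borel, simplified])
  then show ?thesis by (simp only: measure_of_of_measure)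
qed

end

theorem corollary4p2:
  fixes S :: "(int ^ 'n) set"
  assumes "finite S" and "symmetric_set S" and "generating_set S"
  shows "weak_conv_borel (sphere_measure S) (limit_measure S)"
proof -
  interpret lattice_gens S using assms by unfold_locales
  have "prob_space (sphere_measure S n) \<and> sets (sphere_measure S n) = sets borel" for n
    unfolding sphere_measure_eq
    using finite_word_sphere word_sphere_neq_empty
    by (auto intro!: prob_space.prob_space_distr prob_space_uniform_count_measure)
  moreover have "sets (limit_measure S) = sets borel"
    by (simp add: limit_measure_eq cone_prob_def)
  moreover have "(\<lambda>n. integral\<^sup>L (sphere_measure S n) f) \<longlonglongrightarrow> integral\<^sup>L (limit_measure S) f"
    if f: "continuous_on UNIV f" "bounded (range f)" for f :: "real ^ 'n \<Rightarrow> real"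
  proof -
    obtain B where B: "\<And>x. \<bar>f x\<bar> \<le> B" using f(2) unfolding bounded_iff by auto
    have "integral\<^sup>L (sphere_measure S n) f
      = (\<Sum>w\<in>word_sphere S n. f ((1 / real n) *\<^sub>R of_lattice w)) / card (word_sphere S n)" for n
    proof -
      have "f \<in> borel_measurable borel" using f(1) by (rule borel_measurable_continuous_onI)
      then show ?thesis
        unfolding sphere_measure_eq using finite_word_sphere
        by (subst integral_distr) (auto simp: integral_uniform_count_measure)
    qed
    then show ?thesis
      using sphere_average_tendsto[OF f(1) B] by (simp add: limit_measure_eq)
  qed
  ultimately show ?thesis
    unfolding weak_conv_borel_def using prob_space_cone_prob by (simp add: limit_measure_eq)
qed

end
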